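(* Let $\hbar>0$ and let $n,m$ be integers with $n,m\ge 1$. With the projections $p_j = g_j(u+\hbar)W+f_j(u)+g_j(u)W^{-1}\in\mathcal{C}_\hbar^\infty$, $j\ge 1$ (as defined in the context), one has $$p_n\mathcal{C}_\hbar^\infty\oplus p_m\mathcal{C}_\hbar^\infty\simeq p_{n+m}\mathcal{C}_\hbar^\infty$$ as right $\mathcal{C}_\hbar^\infty$-modules.
   Context: Let $\mathcal{S}(\mathbb{R}\times S^1)$ ($S^1=\mathbb{R}/\mathbb{Z}$) be the Schwartz functions on $\mathbb{R}\times S^1$; with $W=e^{2\pi i t}$, each is written $f(u,t)=\sum_{n\in\mathbb{Z}}f_n(u)W^n$ with $f_n\in\mathcal{S}(\mathbb{R})$. The algebra $\mathcal{C}_\hbar^\infty$ (nonunital) is this vector space with the product $fg=\sum_{n}\big[\sum_{k}f_k(u)g_{n-k}(u+k\hbar)\big]W^n$ (so $W^nf(u)=f(u+n\hbar)W^n$) and involution $f^*=\sum_n\overline{f_{-n}(u+n\hbar)}W^n$. Construction of $p_j$. Let $\phi_0$ be a function increasing smoothly from $0$ to $1$ on $[0,\hbar]$, and define $f,g:\mathbb{R}\to\mathbb{R}$ by: $f(u)=0$ if $u\le 0$ or $u\ge 2\hbar$, $f(u)=\phi_0(u)$ if $0\le u\le\hbar$, $f(u)=1-\phi_0(u-\hbar)$ if $\hbar\le u\le 2\hbar$; $g(u)=0$ if $u\le\hbar$ or $u\ge 2\hbar$, $g(u)=\sqrt{f(u)-f(u)^2}$ if $\hbar\le u\le 2\hbar$.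 The function $\phi_0$ is assumed chosen so that $f$ and $g$ are smooth on $\mathbb{R}$. For $j\ge1$ set $f_j(u)=\sum_{k=1}^jW^{-2k}f(u)W^{2k}=\sum_{k=1}^jf(u-2k\hbar)$ and $g_j(u)=\sum_{k=1}^jW^{-2k}g(u)W^{2k}=\sum_{k=1}^jg(u-2k\hbar)$. Each $p_j$ is a projection ($p_j^2=p_j=p_j^*$), and the same $\phi_0$ is used for all $j$. *)

theory Defs
  imports "HOL-Analysis.Analysis"
begin

text \<open>
  Functions on the cylinder \<open>\<real> \<times> S\<^sup>1\<close> with \<open>S\<^sup>1 = \<real>/\<int>\<close> are functions of \<open>(u, t) \<in> \<real> \<times> \<real>\<close> that are
  1-periodic in \<open>t\<close>.  In the definition below \<open>D a b\<close> is the partial derivative of \<open>F\<close> of order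
  \<open>a\<close> in \<open>u\<close> and \<open>b\<close> in \<open>t\<close>; requiring each of them to be (totally) differentiable says that \<open>F\<close>
  is infinitely differentiable.
\<close>

definition schwartz_cyl :: "(real \<times> real \<Rightarrow> complex) set" where
  "schwartz_cyl = {F.
     (\<forall>u t. F (u, t + 1) = F (u, t)) \<and>
     (\<exists>D :: nat \<Rightarrow> nat \<Rightarrow> real \<times> real \<Rightarrow> complex.
        D 0 0 = F \<and>
        (\<forall>a b z. (D a b has_derivative
                    (\<lambda>(x, y). x *\<^sub>R D (Suc a) b z + y *\<^sub>R D a (Suc b) z)) (at z)) \<and>
        (\<forall>k a b. \<exists>C. \<forall>u t. \<bar>u\<bar> ^ k * norm (D a b (u, t)) \<le> C))}"

definition W :: "real \<Rightarrow> complex" where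
  "W t = exp (2 * of_real pi * \<i> * of_real t)"

text \<open>The coefficients \<open>F\<^sub>n\<close> in \<open>F(u,t) = \<Sum>\<^sub>n F\<^sub>n(u) W\<^sup>n\<close>.\<close>

definition fcoeff :: "(real \<times> real \<Rightarrow> complex) \<Rightarrow> int \<Rightarrow> real \<Rightarrow> complex" where
  "fcoeff F n u = integral {0..1} (\<lambda>t. F (u, t) * W t powi (- n))"

text \<open>
  The product of the algebra; \<open>h\<close> is the deformation parameter.
\<close>

definition cmult :: "real \<Rightarrow> (real \<times> real \<Rightarrow> complex) \<Rightarrow> (real \<times> real \<Rightarrow> complex)
    \<Rightarrow> (real \<times> real \<Rightarrow> complex)" where
  "cmult h F G = (\<lambda>(u, t).
     \<Sum>\<^sub>\<infinity>n\<in>UNIV. (\<Sum>\<^sub>\<infinity>k\<in>UNIV. fcoeff F k u * fcoeff G (n - k) (u + of_int k * h)) * W t powi n)"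

text \<open>
  Right modules over a nonunital complex algebra, whose elements have type \<open>'a\<close>: a carrier with
  addition, complex scalar multiplication and right action.  The record only carries the
  operations; their values outside the carriers are irrelevant.
\<close>

record ('a, 'm) rmod =
  mcarrier :: "'m set"
  madd :: "'m \<Rightarrow> 'm \<Rightarrow> 'm"
  mscale :: "complex \<Rightarrow> 'm \<Rightarrow> 'm"
  mact :: "'m \<Rightarrow> 'a \<Rightarrow> 'm"

definition rmod_dsum :: "('a, 'm) rmod \<Rightarrow> ('a, 'n) rmod \<Rightarrow> ('a, 'm \<times> 'n) rmod" where
  "rmod_dsum M N = \<lparr>
     mcarrier = mcarrier M \<times> mcarrier N,
     madd = (\<lambda>(x, y) (x', y'). (madd M x x', madd N y y')),
     mscale = (\<lambda>c (x, y). (mscale M c x, mscale N c y)),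
     mact = (\<lambda>(x, y) a. (mact M x a, mact N y a))\<rparr>"

definition rmod_isomorphic :: "'a set \<Rightarrow> ('a, 'm) rmod \<Rightarrow> ('a, 'n) rmod \<Rightarrow> bool" where
  "rmod_isomorphic A M N \<longleftrightarrow>
     (\<exists>\<Phi>. bij_betw \<Phi> (mcarrier M) (mcarrier N) \<and>
        (\<forall>x\<in>mcarrier M. \<forall>y\<in>mcarrier M. \<Phi> (madd M x y) = madd N (\<Phi> x) (\<Phi> y)) \<and>
        (\<forall>c. \<forall>x\<in>mcarrier M. \<Phi> (mscale M c x) = mscale N c (\<Phi> x)) \<and>
        (\<forall>x\<in>mcarrier M. \<forall>a\<in>A. \<Phi> (mact M x a) = mact N (\<Phi> x) a))"

text \<open>The right module generated by \<open>p\<close>, that is \<open>p\<close> times the algebra.\<close>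

definition principal_rmod ::
  "real \<Rightarrow> (real \<times> real \<Rightarrow> complex) \<Rightarrow> (real \<times> real \<Rightarrow> complex, real \<times> real \<Rightarrow> complex) rmod" where
  "principal_rmod h p = \<lparr>
     mcarrier = {cmult h p a | a. a \<in> schwartz_cyl},
     madd = (\<lambda>x y z. x z + y z),
     mscale = (\<lambda>c x z. c * x z),
     mact = cmult h\<rparr>"

text \<open>At the end points of a closed interval the derivatives are one-sided.\<close>

definition smooth_real_on :: "real set \<Rightarrow> (real \<Rightarrow> real) \<Rightarrow> bool" where
  "smooth_real_on S f \<longleftrightarrow>
     (\<exists>D :: nat \<Rightarrow> real \<Rightarrow> real. D 0 = f \<and>
        (\<forall>k. \<forall>x\<in>S. (D k has_real_derivative D (Suc k) x) (at x within S)))"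

definition f_fun :: "real \<Rightarrow> (real \<Rightarrow> real) \<Rightarrow> real \<Rightarrow> real" where
  "f_fun h \<phi> u =
     (if u \<le> 0 \<or> u \<ge> 2 * h then 0
      else if u \<le> h then \<phi> u
      else 1 - \<phi> (u - h))"

definition g_fun :: "real \<Rightarrow> (real \<Rightarrow> real) \<Rightarrow> real \<Rightarrow> real" where
  "g_fun h \<phi> u =
     (if u \<le> h \<or> u \<ge> 2 * h then 0 else sqrt (f_fun h \<phi> u - (f_fun h \<phi> u)\<^sup>2))"

definition f_sum :: "real \<Rightarrow> (real \<Rightarrow> real) \<Rightarrow> nat \<Rightarrow> real \<Rightarrow> real" where
  "f_sum h \<phi> j u = (\<Sum>k = 1..j. f_fun h \<phi> (u - 2 * real k * h))"

definition g_sum :: "real \<Rightarrow> (real \<Rightarrow> real) \<Rightarrow> nat \<Rightarrow> real \<Rightarrow> real" where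
  "g_sum h \<phi> j u = (\<Sum>k = 1..j. g_fun h \<phi> (u - 2 * real k * h))"

definition proj :: "real \<Rightarrow> (real \<Rightarrow> real) \<Rightarrow> nat \<Rightarrow> real \<times> real \<Rightarrow> complex" where
  "proj h \<phi> j = (\<lambda>(u, t).
     of_real (g_sum h \<phi> j (u + h)) * W t + of_real (f_sum h \<phi> j u)
       + of_real (g_sum h \<phi> j u) * inverse (W t))"

text \<open>
  The admissible profiles \<open>\<phi>\<^sub>0\<close>; only the values of \<open>\<phi>\<close> on \<open>[0, h]\<close> matter.
\<close>

definition admissible_profile :: "real \<Rightarrow> (real \<Rightarrow> real) \<Rightarrow> bool" where
  "admissible_profile h \<phi> \<longleftrightarrow>
     mono_on {0..h} \<phi> \<and> \<phi> 0 = 0 \<and> \<phi> h = 1 \<and> smooth_real_on {0..h} \<phi> \<and>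
     smooth_real_on UNIV (f_fun h \<phi>) \<and> smooth_real_on UNIV (g_fun h \<phi>)"

end

theory Submission
  imports Defs
begin

text \<open>
  Left multiplication by a projection acts on Schwartz functions as the three-term operator \<open>tridiag\<close>;
  this is where Fourier inversion on the circle enters, because the product is defined through
  Fourier coefficients. The bumps of \<open>p\<^sub>j\<close> occupy the cells \<open>[2 q h, 2 (q + 1) h]\<close> with \<open>1 \<le> q \<le> j\<close>,
  and the operators belonging to two sets of cells multiply to the one of their intersection. Hence
  \<open>p\<^bsub>n+m\<^esub>\<close> is the orthogonal sum of \<open>p\<^sub>n\<close> and \<open>W\<^bsup>-2n\<^esup> p\<^sub>m W\<^bsup>2n\<^esup>\<close>, and
  \<open>(x, y) \<mapsto> x + W\<^bsup>-2n\<^esup> y\<close> is the required isomorphism.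
\<close>

section \<open>Schwartz functions on the cylinder\<close>

text \<open>Multiplying in the algebra means rearranging double series of Fourier coefficients. Once
  left multiplication by \<open>proj\<close> acts pointwise in \<open>(u, t)\<close>, every relation
  among the projections is an identity between finitely many values of \<open>f_fun\<close> and
  \<open>g_fun\<close>. Distinct cells do not interact because \<open>g_fun\<close> lives on the
  upper half of its cell: at each \<open>u\<close>, the coefficients of the operator that can be
  nonzero all come from the one cell containing \<open>u\<close>. The exponent \<open>2 * n\<close>
  arises because a cell has width \<open>2 * h\<close> while one power of \<open>W\<close>
  translates by \<open>h\<close>; the cells 1, ..., m are thus carried onto n + 1, ..., n + m. The
  nonunital algebra does not contain this power of \<open>W\<close>, so it acts as a left
  multiplier. Left multipliers commute with right multiplication, which makes the map one of right
  modules. Its bijectivity rests on describing each principal module as the Schwartz functions fixed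
  by the operator of its projection.\<close>

type_synonym jet = "nat \<Rightarrow> nat \<Rightarrow> real \<times> real \<Rightarrow> complex"

text \<open>A jet is a full table of mixed partial derivatives. Carrying the table explicitly
  reduces each closure property of \<open>schwartz_cyl\<close> to writing down a new table.\<close>

definition cyl_jet :: "jet \<Rightarrow> bool" where
  "cyl_jet D \<longleftrightarrow> (\<forall>a b z. (D a b has_derivative
      (\<lambda>v. fst v *\<^sub>R D (Suc a) b z + snd v *\<^sub>R D a (Suc b) z)) (at z))"

definition rapidly_decreasing_jet :: "jet \<Rightarrow> bool" where
  "rapidly_decreasing_jet D \<longleftrightarrow>
     (\<forall>k a b. \<exists>C. \<forall>u t. \<bar>u\<bar> ^ k * norm (D a b (u, t)) \<le> C)"

text \<open>The class of multipliers: all derivatives bounded but no decay in \<open>u\<close>, so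
  that the powers of \<open>W\<close> belong to it.\<close>

definition bounded_jet :: "jet \<Rightarrow> bool" where
  "bounded_jet D \<longleftrightarrow> (\<forall>a b. \<exists>C. \<forall>z. norm (D a b z) \<le> C)"

lemma schwartz_cyl_iff:
  "F \<in> schwartz_cyl \<longleftrightarrow> (\<forall>u t. F (u, t + 1) = F (u, t)) \<and>
     (\<exists>D. D 0 0 = F \<and> cyl_jet D \<and> rapidly_decreasing_jet D)"
  by (simp add: schwartz_cyl_def cyl_jet_def rapidly_decreasing_jet_def case_prod_beta'
      del: split_paired_All)

lemma schwartz_cylI:
  assumes "\<And>u t. F (u, t + 1) = F (u, t)" "D 0 0 = F" "cyl_jet D" "rapidly_decreasing_jet D"
  shows "F \<in> schwartz_cyl"
  using assms unfolding schwartz_cyl_iff by blast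

lemma schwartz_cylE:
  assumes "F \<in> schwartz_cyl"
  obtains D where "D 0 0 = F" "cyl_jet D" "rapidly_decreasing_jet D"
  using assms unfolding schwartz_cyl_iff by blast

lemma schwartz_cyl_periodic: "F \<in> schwartz_cyl \<Longrightarrow> F (u, t + 1) = F (u, t)"
  by (simp add: schwartz_cyl_iff)

lemma schwartz_cyl_zero: "(\<lambda>z. 0) \<in> schwartz_cyl"
  by (rule schwartz_cylI[where D = "\<lambda>a b z. 0"])
    (auto simp: cyl_jet_def rapidly_decreasing_jet_def)

lemma weighted_norm_add_le:
  fixes x y :: "'a :: real_normed_vector"
  assumes "0 \<le> w" "w * norm x \<le> C1" "w * norm y \<le> C2"
  shows "w * norm (x + y) \<le> C1 + C2"
  using mult_left_mono[OF norm_triangle_ineq[of x y] assms(1)] assms(2,3)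
  by (simp add: distrib_left)

lemma schwartz_cyl_add:
  assumes "F \<in> schwartz_cyl" "G \<in> schwartz_cyl"
  shows "(\<lambda>z. F z + G z) \<in> schwartz_cyl"
proof -
  obtain D where D: "D 0 0 = F" "cyl_jet D" "rapidly_decreasing_jet D"
    using assms(1) by (rule schwartz_cylE)
  obtain E where E: "E 0 0 = G" "cyl_jet E" "rapidly_decreasing_jet E"
    using assms(2) by (rule schwartz_cylE)
  show ?thesis
  proof (rule schwartz_cylI[where D = "\<lambda>a b z. D a b z + E a b z"])
    show "F (u, t + 1) + G (u, t + 1) = F (u, t) + G (u, t)" for u t
      by (simp add: assms schwartz_cyl_periodic)
    show "(\<lambda>z. D 0 0 z + E 0 0 z) = (\<lambda>z. F z + G z)" by (simp add: D E)
    show "cyl_jet (\<lambda>a b z. D a b z + E a b z)"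
      unfolding cyl_jet_def
    proof (intro allI)
      fix a b and z :: "real \<times> real"
      show "((\<lambda>z. D a b z + E a b z) has_derivative
        (\<lambda>v. fst v *\<^sub>R (D (Suc a) b z + E (Suc a) b z) + snd v *\<^sub>R (D a (Suc b) z + E a (Suc b) z))) (at z)"
        using has_derivative_add[OF D(2)[unfolded cyl_jet_def, rule_format, of a b z]
            E(2)[unfolded cyl_jet_def, rule_format, of a b z]]
        by (simp add: scaleR_add_right ac_simps)
    qed
    show "rapidly_decreasing_jet (\<lambda>a b z. D a b z + E a b z)"
      unfolding rapidly_decreasing_jet_def
    proof (intro allI)
      fix k a b
      obtain C1 C2 where C: "\<And>u t. \<bar>u\<bar> ^ k * norm (D a b (u, t)) \<le> C1"
        "\<And>u t. \<bar>u\<bar> ^ k * norm (E a b (u, t)) \<le> C2"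
        using D(3) E(3) unfolding rapidly_decreasing_jet_def by meson
      have "\<bar>u\<bar> ^ k * norm (D a b (u, t) + E a b (u, t)) \<le> C1 + C2" for u t
        using weighted_norm_add_le[OF _ C] by simp
      then show "\<exists>C. \<forall>u t. \<bar>u\<bar> ^ k * norm (D a b (u, t) + E a b (u, t)) \<le> C" by blast
    qed
  qed
qed

lemma schwartz_cyl_sum:
  assumes "\<And>i. i \<in> I \<Longrightarrow> F i \<in> schwartz_cyl"
  shows "(\<lambda>z. \<Sum>i\<in>I. F i z) \<in> schwartz_cyl"
  using assms
  by (induction I rule: infinite_finite_induct)
    (simp_all add: schwartz_cyl_zero schwartz_cyl_add)

text \<open>The weight \<open>\<bar>u\<bar> ^ k\<close> is not translation invariant. It is traded
  for \<open>2 ^ k * (\<bar>u + c\<bar> ^ k + \<bar>c\<bar> ^ k)\<close>, whose second term is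
  controlled by the decay condition of exponent 0, that is by boundedness.\<close>

lemma schwartz_cyl_shift:
  assumes "F \<in> schwartz_cyl"
  shows "(\<lambda>(u, t). F (u + c, t)) \<in> schwartz_cyl"
proof -
  obtain D where D: "D 0 0 = F" "cyl_jet D" "rapidly_decreasing_jet D"
    using assms(1) by (rule schwartz_cylE)
  show ?thesis
  proof (rule schwartz_cylI[where D = "\<lambda>a b z. D a b (z + (c, 0))"])
    show "(case (u, t + 1) of (u, t) \<Rightarrow> F (u + c, t)) = (case (u, t) of (u, t) \<Rightarrow> F (u + c, t))" for u t
      by (simp add: assms schwartz_cyl_periodic)
    show "(\<lambda>z. D 0 0 (z + (c, 0))) = (\<lambda>(u, t). F (u + c, t))"
      by (auto simp: D)
    show "cyl_jet (\<lambda>a b z. D a b (z + (c, 0)))"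
      unfolding cyl_jet_def
    proof (intro allI)
      fix a b and z :: "real \<times> real"
      have "((\<lambda>z. z + (c, 0)) has_derivative (\<lambda>v. v)) (at z)"
        by (auto intro!: derivative_eq_intros)
      from has_derivative_compose[OF this D(2)[unfolded cyl_jet_def, rule_format, of a b "z + (c, 0)"]]
      show "((\<lambda>z. D a b (z + (c, 0))) has_derivative
        (\<lambda>v. fst v *\<^sub>R D (Suc a) b (z + (c, 0)) + snd v *\<^sub>R D a (Suc b) (z + (c, 0)))) (at z)"
        by simp
    qed
    show "rapidly_decreasing_jet (\<lambda>a b z. D a b (z + (c, 0)))"
      unfolding rapidly_decreasing_jet_def
    proof (intro allI)
      fix k a b
      obtain C1 C2 where C: "\<And>u t. \<bar>u\<bar> ^ k * norm (D a b (u, t)) \<le> C1"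
        "\<And>u t. \<bar>u\<bar> ^ 0 * norm (D a b (u, t)) \<le> C2"
        using D(3) unfolding rapidly_decreasing_jet_def by meson
      have "\<bar>u\<bar> ^ k * norm (D a b ((u, t) + (c, 0))) \<le> 2 ^ k * (C1 + \<bar>c\<bar> ^ k * C2)" for u t
      proof -
        have "\<bar>u\<bar> \<le> 2 * max \<bar>u + c\<bar> \<bar>c\<bar>" 
            using abs_triangle_ineq4[of "u + c" c] by (simp add: max_def)
        then have "\<bar>u\<bar> ^ k \<le> (2 * max \<bar>u + c\<bar> \<bar>c\<bar>) ^ k" by (intro power_mono) auto
        also have "\<dots> \<le> 2 ^ k * (\<bar>u + c\<bar> ^ k + \<bar>c\<bar> ^ k)"
          by (auto simp: power_mult_distrib max_def)
        finally have "\<bar>u\<bar> ^ k * norm (D a b (u + c, t))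
            \<le> (2 ^ k * (\<bar>u + c\<bar> ^ k + \<bar>c\<bar> ^ k)) * norm (D a b (u + c, t))"
          by (rule mult_right_mono) auto
        also have "\<dots> = 2 ^ k * (\<bar>u + c\<bar> ^ k * norm (D a b (u + c, t)) + \<bar>c\<bar> ^ k * norm (D a b (u + c, t)))"
          by (simp add: algebra_simps)
        also have "\<dots> \<le> 2 ^ k * (C1 + \<bar>c\<bar> ^ k * C2)"
          using C(1)[of "u + c" t] C(2)[of "u + c" t]
          by (intro mult_left_mono add_mono) auto
        finally show ?thesis by simp
      qed
      then show "\<exists>C. \<forall>u t. \<bar>u\<bar> ^ k * norm (D a b ((u, t) + (c, 0))) \<le> C" by blast
    qed
  qed
qed

text \<open>Leibniz' rule in a recursive form that avoids binomial coefficients.\<close>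

fun jet_mult :: "nat \<Rightarrow> nat \<Rightarrow> jet \<Rightarrow> jet \<Rightarrow> real \<times> real \<Rightarrow> complex" where
  "jet_mult 0 0 M D z = M 0 0 z * D 0 0 z"
| "jet_mult 0 (Suc b) M D z =
     jet_mult 0 b (\<lambda>i j. M i (Suc j)) D z + jet_mult 0 b M (\<lambda>i j. D i (Suc j)) z"
| "jet_mult (Suc a) b M D z =
     jet_mult a b (\<lambda>i. M (Suc i)) D z + jet_mult a b M (\<lambda>i. D (Suc i)) z"

text \<open>The recursion peels off \<open>u\<close>-derivatives before
  \<open>t\<close>-derivatives; this is the other order, required for the \<open>t\<close>-component
  of the total derivative.\<close>

lemma jet_mult_Suc_right:
  "jet_mult a (Suc b) M D z =
     jet_mult a b (\<lambda>i j. M i (Suc j)) D z + jet_mult a b M (\<lambda>i j. D i (Suc j)) z"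
  by (induction a arbitrary: M D) simp_all

lemma cyl_jet_mult:
  assumes "cyl_jet M" "cyl_jet D"
  shows "cyl_jet (\<lambda>a b. jet_mult a b M D)"
proof -
  have "(jet_mult a b M D has_derivative
      (\<lambda>v. fst v *\<^sub>R jet_mult (Suc a) b M D z + snd v *\<^sub>R jet_mult a (Suc b) M D z)) (at z)"
    for a b z
    using assms
  proof (induction a b M D z rule: jet_mult.induct)
    case (1 M D z)
    have eq: "jet_mult 0 0 M D = (\<lambda>z. M 0 0 z * D 0 0 z)" by auto
    show ?case unfolding eq
      by (rule has_derivative_eq_rhs[OF has_derivative_mult[OF
            1(1)[unfolded cyl_jet_def, rule_format, of 0 0 z]
            1(2)[unfolded cyl_jet_def, rule_format, of 0 0 z]]])
        (auto simp: algebra_simps)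
  next
    case (2 b M D z)
    have eq: "jet_mult 0 (Suc b) M D =
        (\<lambda>z. jet_mult 0 b (\<lambda>i j. M i (Suc j)) D z + jet_mult 0 b M (\<lambda>i j. D i (Suc j)) z)" by auto
    have "cyl_jet (\<lambda>i j. M i (Suc j))" "cyl_jet (\<lambda>i j. D i (Suc j))"
      using 2(3,4) by (auto simp: cyl_jet_def)
    with 2 show ?case unfolding eq
      by (auto intro!: has_derivative_eq_rhs[OF has_derivative_add] simp: algebra_simps)
  next
    case (3 a b M D z)
    have eq: "jet_mult (Suc a) b M D =
        (\<lambda>z. jet_mult a b (\<lambda>i. M (Suc i)) D z + jet_mult a b M (\<lambda>i. D (Suc i)) z)" by auto
    have "cyl_jet (\<lambda>i. M (Suc i))" "cyl_jet (\<lambda>i. D (Suc i))"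
      using 3(3,4) by (auto simp: cyl_jet_def)
    with 3 show ?case unfolding eq
      by (auto intro!: has_derivative_eq_rhs[OF has_derivative_add] simp: algebra_simps jet_mult_Suc_right)
  qed
  then show ?thesis by (simp add: cyl_jet_def)
qed

lemma rapidly_decreasing_jet_mult:
  assumes "bounded_jet M" "rapidly_decreasing_jet D"
  shows "rapidly_decreasing_jet (\<lambda>a b. jet_mult a b M D)"
proof -
  have "\<exists>C. \<forall>u t. \<bar>u\<bar> ^ k * norm (jet_mult a b M D (u, t)) \<le> C" for k a b
    using assms
  \<comment> \<open>The claim ranges over all points already, so the point argument of the induction
    rule is filled with the origin as a dummy.\<close>
  proof (induction a b M D "(0::real, 0::real)" rule: jet_mult.induct)
    case (1 M D)
    obtain B where B: "\<And>z. norm (M 0 0 z) \<le> B"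
      using 1 unfolding bounded_jet_def by meson
    obtain C where C: "\<And>u t. \<bar>u\<bar> ^ k * norm (D 0 0 (u, t)) \<le> C"
      using 1 unfolding rapidly_decreasing_jet_def by meson
    have "\<bar>u\<bar> ^ k * norm (jet_mult 0 0 M D (u, t)) \<le> B * C" for u t
    proof -
      have "norm (M 0 0 (u, t)) * (\<bar>u\<bar> ^ k * norm (D 0 0 (u, t))) \<le> B * C"
        using order_trans[OF norm_ge_zero B] by (intro mult_mono B C) auto
      then show ?thesis by (simp add: norm_mult mult_ac)
    qed
    then show ?case by blast
  next
    case (2 b M D)
    have "bounded_jet (\<lambda>i j. M i (Suc j))" "rapidly_decreasing_jet (\<lambda>i j. D i (Suc j))"
      using 2(3,4) by (auto simp: bounded_jet_def rapidly_decreasing_jet_def)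
    with 2 obtain C1 C2 where C:
      "\<And>u t. \<bar>u\<bar> ^ k * norm (jet_mult 0 b (\<lambda>i j. M i (Suc j)) D (u, t)) \<le> C1"
      "\<And>u t. \<bar>u\<bar> ^ k * norm (jet_mult 0 b M (\<lambda>i j. D i (Suc j)) (u, t)) \<le> C2"
      by meson
    have "\<bar>u\<bar> ^ k * norm (jet_mult 0 (Suc b) M D (u, t)) \<le> C1 + C2" for u t
      using weighted_norm_add_le[OF _ C] by simp
    then show ?case by blast
  next
    case (3 a b M D)
    have "bounded_jet (\<lambda>i. M (Suc i))" "rapidly_decreasing_jet (\<lambda>i. D (Suc i))"
      using 3(3,4) by (auto simp: bounded_jet_def rapidly_decreasing_jet_def)
    with 3 obtain C1 C2 where C:
      "\<And>u t. \<bar>u\<bar> ^ k * norm (jet_mult a b (\<lambda>i. M (Suc i)) D (u, t)) \<le> C1"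
      "\<And>u t. \<bar>u\<bar> ^ k * norm (jet_mult a b M (\<lambda>i. D (Suc i)) (u, t)) \<le> C2"
      by meson
    have "\<bar>u\<bar> ^ k * norm (jet_mult (Suc a) b M D (u, t)) \<le> C1 + C2" for u t
      using weighted_norm_add_le[OF _ C] by simp
    then show ?case by blast
  qed
  then show ?thesis by (simp add: rapidly_decreasing_jet_def)
qed

lemma schwartz_cyl_mult:
  assumes "F \<in> schwartz_cyl" "cyl_jet M" "bounded_jet M"
    and "\<And>u t. M 0 0 (u, t + 1) = M 0 0 (u, t)"
  shows "(\<lambda>z. M 0 0 z * F z) \<in> schwartz_cyl"
proof -
  obtain D where D: "D 0 0 = F" "cyl_jet D" "rapidly_decreasing_jet D"
    using assms(1) by (rule schwartz_cylE)
  show ?thesis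
    by (rule schwartz_cylI[where D = "\<lambda>a b. jet_mult a b M D"])
      (auto simp: D assms schwartz_cyl_periodic cyl_jet_mult rapidly_decreasing_jet_mult)
qed

text \<open>Every derivative is continuous, hence bounded on \<open>{a..b}\<close>. Outside, the
  function vanishes on an open set, so its derivatives vanish there as well.\<close>

lemma bounded_derivatives_of_compact_support:
  fixes D :: "nat \<Rightarrow> real \<Rightarrow> real"
  assumes "\<And>k x. (D k has_real_derivative D (Suc k) x) (at x)"
    and "\<And>x. x < a \<or> x > b \<Longrightarrow> D 0 x = 0"
  shows "\<exists>C. \<forall>x. \<bar>D k x\<bar> \<le> C"
proof -
  define U where "U = {..<a} \<union> {b<..}"
  have zero: "D k x = 0" if "x \<in> U" for k x
    using that
  proof (induction k arbitrary: x)
    case 0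
    then show ?case using assms(2) by (auto simp: U_def)
  next
    case (Suc k)
    have "open U" by (auto simp: U_def)
    with Suc have "(D k has_real_derivative 0) (at x)"
      using has_field_derivative_transform_within_open[of "\<lambda>_. 0" 0 x U "D k"] by auto
    then show ?case using assms(1) DERIV_unique by blast
  qed
  have "continuous_on {a..b} (D k)"
    using assms(1) DERIV_continuous_on[of "{a..b}" "D k" "D (Suc k)"]
    by (meson has_field_derivative_at_within)
  then have "bounded (D k ` {a..b})"
    by (intro compact_imp_bounded compact_continuous_image) auto
  then obtain C where "\<forall>x\<in>{a..b}. \<bar>D k x\<bar> \<le> C" unfolding bounded_real by auto
  then have "\<bar>D k x\<bar> \<le> max C 0" for x
    using zero[of x k] by (cases "x \<in> {a..b}") (force simp: U_def)+
  then show ?thesis by blast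
qed

lemma schwartz_cyl_mult_bump:
  assumes "F \<in> schwartz_cyl" "smooth_real_on UNIV f" "\<And>x. x < a \<or> x > b \<Longrightarrow> f x = 0"
  shows "(\<lambda>(u, t). of_real (f (u + c)) * F (u, t)) \<in> schwartz_cyl"
proof -
  obtain D where D: "D 0 = f" "\<And>k x. (D k has_real_derivative D (Suc k) x) (at x)"
    using assms(2) unfolding smooth_real_on_def by auto
  have bdd: "\<exists>C. \<forall>x. \<bar>D k x\<bar> \<le> C" for k
    by (rule bounded_derivatives_of_compact_support[of D a b]) (use D assms in auto)
  \<comment> \<open>The bump depends on \<open>u\<close> alone, so all entries with a
    \<open>t\<close>-derivative are zero.\<close>
  define M :: jet where "M = (\<lambda>i j z. if j = 0 then of_real (D i (fst z + c)) else 0)"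
  have "cyl_jet M"
    unfolding cyl_jet_def
  proof (intro allI)
    fix i j and z :: "real \<times> real"
    show "(M i j has_derivative (\<lambda>v. fst v *\<^sub>R M (Suc i) j z + snd v *\<^sub>R M i (Suc j) z)) (at z)"
    proof (cases "j = 0")
      case True
      have "((\<lambda>z. fst z + c) has_derivative fst) (at z)"
        by (auto intro!: derivative_eq_intros)
      from has_derivative_compose[OF this D(2)[unfolded has_field_derivative_def, of i]]
      have "((\<lambda>z. complex_of_real (D i (fst z + c))) has_derivative
          (\<lambda>v. of_real (D (Suc i) (fst z + c) * fst v))) (at z)"
        by (rule has_derivative_of_real)
      then show ?thesis
        by (simp add: M_def True scaleR_conv_of_real mult.commute)
    qed (simp add: M_def)
  qed
  moreover have "bounded_jet M"
    unfolding bounded_jet_def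
  proof (intro allI)
    fix i j
    obtain C where "\<forall>x. \<bar>D i x\<bar> \<le> C" using bdd by blast
    then have "norm (M i j z) \<le> C" for z
      by (auto simp: M_def intro: order_trans[OF abs_ge_zero])
    then show "\<exists>C. \<forall>z. norm (M i j z) \<le> C" by blast
  qed
  ultimately have "(\<lambda>z. M 0 0 z * F z) \<in> schwartz_cyl"
    using assms(1) by (intro schwartz_cyl_mult) (auto simp: M_def)
  then show ?thesis by (simp add: M_def D case_prod_beta')
qed

section \<open>The characters of the circle as multipliers, and derivatives in
  \<open>t\<close>\<close>

lemma W_add: "W (s + t) = W s * W t"
  by (simp add: W_def exp_add algebra_simps)

lemma W_1 [simp]: "W 1 = 1"
  by (simp add: W_def)

lemma W_nonzero [simp]: "W t \<noteq> 0"
  by (simp add: W_def)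

lemma norm_W [simp]: "norm (W t) = 1"
  by (simp add: W_def)

lemma norm_W_powi [simp]: "norm (W t powi n) = 1"
  by (simp add: norm_power_int)

lemma W_powi: "W t powi n = exp (2 * of_real pi * \<i> * of_int n * of_real t)"
proof (cases "n \<ge> 0")
  case True
  then show ?thesis by (simp add: W_def power_int_def exp_of_nat_mult[symmetric] algebra_simps)
next
  case False
  then have "of_nat (nat (- n)) = - (of_int n :: complex)" by simp
  with False show ?thesis
    by (simp add: W_def power_int_def exp_of_nat_mult[symmetric] exp_minus[symmetric] algebra_simps)
qed

lemma W_powi_has_vector_derivative:
  "((\<lambda>t. W t powi n) has_vector_derivative (2 * of_real pi * \<i> * of_int n) * W t powi n) (at t within S)"
  unfolding W_powi
  by (auto intro!: derivative_eq_intros has_vector_derivative_real_field simp: algebra_simps)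

lemma schwartz_cyl_mult_W_powi:
  assumes "F \<in> schwartz_cyl"
  shows "(\<lambda>(u, t). W t powi n * F (u, t)) \<in> schwartz_cyl"
proof -
  define c where "c = 2 * complex_of_real pi * \<i> * of_int n"
  \<comment> \<open>\<open>W t powi n\<close> is an eigenfunction of the derivative in
    \<open>t\<close> with eigenvalue \<open>c\<close>, and constant in \<open>u\<close>.\<close>
  define M :: jet where "M = (\<lambda>i j z. if i = 0 then c ^ j * W (snd z) powi n else 0)"
  have "cyl_jet M"
    unfolding cyl_jet_def
  proof (intro allI)
    fix i j and z :: "real \<times> real"
    show "(M i j has_derivative (\<lambda>v. fst v *\<^sub>R M (Suc i) j z + snd v *\<^sub>R M i (Suc j) z)) (at z)"
    proof (cases "i = 0")
      case True
      have "((\<lambda>z. W (snd z) powi n) has_derivative (\<lambda>v. snd v *\<^sub>R (c * W (snd z) powi n))) (at z)"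
        by (rule has_derivative_compose[OF has_derivative_snd[OF has_derivative_ident]
              W_powi_has_vector_derivative[unfolded has_vector_derivative_def, of n, folded c_def]])
      from has_derivative_mult_right[OF this, of "c ^ j"]
      show ?thesis by (simp add: M_def True mult_ac)
    qed (simp add: M_def)
  qed
  moreover have "bounded_jet M"
    unfolding bounded_jet_def
  proof (intro allI)
    fix i j
    have "norm (M i j z) \<le> norm c ^ j" for z
      by (auto simp: M_def norm_mult norm_power)
    then show "\<exists>C. \<forall>z. norm (M i j z) \<le> C" by blast
  qed
  ultimately have "(\<lambda>z. M 0 0 z * F z) \<in> schwartz_cyl"
    using assms(1) by (intro schwartz_cyl_mult) (auto simp: M_def W_add)
  then show ?thesis by (simp add: M_def case_prod_beta')
qed

lemma schwartz_cyl_bounded: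
  assumes "F \<in> schwartz_cyl"
  obtains C where "\<And>z. norm (F z) \<le> C"
proof -
  obtain D where D: "D 0 0 = F" "cyl_jet D" "rapidly_decreasing_jet D"
    using assms(1) by (rule schwartz_cylE)
  obtain C where "\<And>u t. \<bar>u\<bar> ^ 0 * norm (D 0 0 (u, t)) \<le> C"
    using D(3) unfolding rapidly_decreasing_jet_def by meson
  then show ?thesis by (intro that[of C]) (auto simp: D)
qed

text \<open>Keeps the \<open>t\<close>-derivative inside \<open>schwartz_cyl\<close>, so that
  integration by parts can be repeated. A jet says nothing about periodicity of its higher entries;
  that follows from uniqueness of the derivative of \<open>F (u, t + 1) = F (u, t)\<close>.\<close>

lemma schwartz_cyl_partial_t:
  assumes "F \<in> schwartz_cyl"
  shows "\<exists>F'\<in>schwartz_cyl. \<forall>u t. ((\<lambda>t. F (u, t)) has_vector_derivative F' (u, t)) (at t)"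
proof -
  obtain D where D: "D 0 0 = F" "cyl_jet D" "rapidly_decreasing_jet D"
    using assms(1) by (rule schwartz_cylE)
  have deriv: "((\<lambda>t. F (u, t)) has_vector_derivative D 0 1 (u, t)) (at t)" for u t
  proof -
    have "((\<lambda>t. (u, t)) has_derivative (\<lambda>v. (0, v))) (at t)"
      by (auto intro!: derivative_eq_intros)
    from has_derivative_compose[OF this D(2)[unfolded cyl_jet_def, rule_format, of 0 0]]
    show ?thesis by (simp add: D has_vector_derivative_def)
  qed
  have per: "D 0 1 (u, t + 1) = D 0 1 (u, t)" for u t
  proof -
    have "((\<lambda>t. F (u, t + 1)) has_vector_derivative D 0 1 (u, t + 1)) (at t)"
    proof -
      have "((\<lambda>t. t + 1) has_vector_derivative 1) (at t)"
        by (auto intro!: derivative_eq_intros)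
      from vector_diff_chain_at[OF this deriv[of u "t + 1"]]
      show ?thesis by (simp add: o_def)
    qed
    then have "((\<lambda>t. F (u, t)) has_vector_derivative D 0 1 (u, t + 1)) (at t)"
      by (simp add: assms schwartz_cyl_periodic)
    then show ?thesis using deriv vector_derivative_unique_at by blast
  qed
  have "D 0 1 \<in> schwartz_cyl"
    by (rule schwartz_cylI[where D = "\<lambda>a b. D a (Suc b)"])
      (use D per in \<open>auto simp: cyl_jet_def rapidly_decreasing_jet_def\<close>)
  with deriv show ?thesis by auto
qed

lemma schwartz_cyl_continuous_on:
  assumes "F \<in> schwartz_cyl"
  shows "continuous_on S (\<lambda>t. F (u, t))"
proof -
  obtain F' where "F' \<in> schwartz_cyl"
    and "\<And>u t. ((\<lambda>t. F (u, t)) has_vector_derivative F' (u, t)) (at t)"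
    using schwartz_cyl_partial_t[OF assms] by metis
  then show ?thesis
    by (intro continuous_at_imp_continuous_on ballI) (auto intro: has_vector_derivative_continuous)
qed

section \<open>Fourier series\<close>

lemma W_powi_has_integral:
  "((\<lambda>t. W t powi n) has_integral (if n = 0 then 1 else 0)) {0..1}"
proof (cases "n = 0")
  case True
  then show ?thesis using has_integral_const_real[of "1::complex" 0 1] by simp
next
  case False
  define c where "c = 2 * complex_of_real pi * \<i> * of_int n"
  have "c \<noteq> 0" using False by (simp add: c_def)
  have "((\<lambda>t. W t powi n) has_integral (W 1 powi n / c - W 0 powi n / c)) {0..1}"
  proof (rule fundamental_theorem_of_calculus)
    fix x :: real
    have "((\<lambda>t. W t powi n / c) has_vector_derivative c * W x powi n / c) (at x within {0..1})"
      unfolding c_def by (intro has_vector_derivative_divide W_powi_has_vector_derivative)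
    then show "((\<lambda>t. W t powi n / c) has_vector_derivative W x powi n) (at x within {0..1})"
      using \<open>c \<noteq> 0\<close> by simp
  qed simp
  then show ?thesis using False by (simp add: W_def)
qed

lemma schwartz_cyl_times_W_powi_integrable:
  assumes "F \<in> schwartz_cyl"
  shows "(\<lambda>t. F (u, t) * W t powi n) integrable_on {0..1}"
proof -
  have "continuous_on {0..1} (\<lambda>t. W t powi n)"
    unfolding W_powi by (intro continuous_intros)
  then show ?thesis
    by (intro integrable_continuous_interval continuous_on_mult
        schwartz_cyl_continuous_on assms)
qed

lemma fcoeff_add:
  assumes "F \<in> schwartz_cyl" "G \<in> schwartz_cyl"
  shows "fcoeff (\<lambda>z. F z + G z) n u = fcoeff F n u + fcoeff G n u"
  unfolding fcoeff_def
  by (simp add: distrib_right integral_add schwartz_cyl_times_W_powi_integrable assms)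

lemma norm_fcoeff_le:
  assumes "F \<in> schwartz_cyl" "\<And>z. norm (F z) \<le> C"
  shows "norm (fcoeff F n u) \<le> C"
proof -
  have "norm (fcoeff F n u) \<le> integral {0..1::real} (\<lambda>t. C)"
    unfolding fcoeff_def
    by (rule integral_norm_bound_integral)
      (use assms in \<open>auto simp: norm_mult intro: schwartz_cyl_times_W_powi_integrable\<close>)
  then show ?thesis by simp
qed

text \<open>Integration by parts: \<open>F (u, t) * W t powi (- n)\<close> takes the same value at 0
  and 1, so its derivative integrates to zero.\<close>

lemma fcoeff_partial_t:
  assumes "F \<in> schwartz_cyl" "G \<in> schwartz_cyl"
    and "\<And>u t. ((\<lambda>t. F (u, t)) has_vector_derivative G (u, t)) (at t)"
  shows "fcoeff G n u = 2 * of_real pi * \<i> * of_int n * fcoeff F n u"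
proof -
  define c where "c = 2 * complex_of_real pi * \<i> * of_int n"
  have "((\<lambda>t. G (u, t) * W t powi (- n) - c * (F (u, t) * W t powi (- n))) has_integral
      (F (u, 1) * W 1 powi (- n) - F (u, 0) * W 0 powi (- n))) {0..1}"
  proof (rule fundamental_theorem_of_calculus)
    fix x :: real
    have "((\<lambda>t. F (u, t) * W t powi (- n)) has_vector_derivative
        F (u, x) * ((2 * of_real pi * \<i> * of_int (- n)) * W x powi (- n)) + G (u, x) * W x powi (- n))
        (at x within {0..1})"
      by (intro has_vector_derivative_mult W_powi_has_vector_derivative
          has_vector_derivative_at_within[OF assms(3)])
    then show "((\<lambda>t. F (u, t) * W t powi (- n)) has_vector_derivative
        G (u, x) * W x powi (- n) - c * (F (u, x) * W x powi (- n))) (at x within {0..1})"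
      by (rule has_vector_derivative_eq_rhs) (simp add: c_def algebra_simps)
  qed simp
  also have "F (u, 1) * W 1 powi (- n) - F (u, 0) * W 0 powi (- n) = 0"
    using schwartz_cyl_periodic[OF assms(1), of u 0] by (simp add: W_def)
  finally have zero: "((\<lambda>t. G (u, t) * W t powi (- n) - c * (F (u, t) * W t powi (- n))) has_integral 0) {0..1}" .
  have "((\<lambda>t. G (u, t) * W t powi (- n) - c * (F (u, t) * W t powi (- n))) has_integral
      (fcoeff G n u - c * fcoeff F n u)) {0..1}"
    unfolding fcoeff_def
    by (intro has_integral_diff has_integral_mult_right integrable_integral
        schwartz_cyl_times_W_powi_integrable assms)
  from has_integral_unique[OF this zero] show ?thesis by (simp add: c_def)
qed

text \<open>Two derivatives give quadratic decay, which is summable over the integers; the summand 1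
  lets the same bound cover \<open>n = 0\<close>.\<close>

abbreviation decay_weight :: "int \<Rightarrow> real" where
  "decay_weight n \<equiv> inverse (1 + (real_of_int n)\<^sup>2)"

text \<open>A bound \<open>A\<close> for \<open>F\<close> controls the coefficient itself, and a
  bound \<open>B\<close> for the second \<open>t\<close>-derivative controls
  \<open>n\<^sup>2\<close> times it, the factor \<open>(2 * pi)\<^sup>2\<close> being at least 1.
  Both bounds are uniform in \<open>u\<close>.\<close>

lemma fcoeff_decay:
  assumes "F \<in> schwartz_cyl"
  obtains C where "\<And>n u. norm (fcoeff F n u) \<le> C * decay_weight n"
proof -
  obtain G where G: "G \<in> schwartz_cyl"
    "\<And>u t. ((\<lambda>t. F (u, t)) has_vector_derivative G (u, t)) (at t)"
    using schwartz_cyl_partial_t[OF assms] by metis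
  obtain H where H: "H \<in> schwartz_cyl"
    "\<And>u t. ((\<lambda>t. G (u, t)) has_vector_derivative H (u, t)) (at t)"
    using schwartz_cyl_partial_t[OF G(1)] by metis
  obtain A where A: "\<And>z. norm (F z) \<le> A" by (rule schwartz_cyl_bounded[OF assms]) blast
  obtain B where B: "\<And>z. norm (H z) \<le> B" by (rule schwartz_cyl_bounded[OF H(1)]) blast
  have "norm (fcoeff F n u) \<le> (A + B) * decay_weight n" for n u
  proof -
    have "fcoeff H n u = (2 * of_real pi * \<i> * of_int n)\<^sup>2 * fcoeff F n u"
      by (simp add: fcoeff_partial_t[OF G(1) H] fcoeff_partial_t[OF assms G] power2_eq_square)
    then have "norm (fcoeff H n u) = (2 * pi)\<^sup>2 * (of_int n)\<^sup>2 * norm (fcoeff F n u)"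
      by (simp add: norm_mult norm_power power_mult_distrib)
    then have "(2 * pi)\<^sup>2 * (of_int n)\<^sup>2 * norm (fcoeff F n u) \<le> B"
      using norm_fcoeff_le[OF H(1) B, of n u] by simp
    moreover have "1\<^sup>2 \<le> (2 * pi)\<^sup>2" using pi_gt3 by (intro power_mono) auto
    then have "1 * ((of_int n)\<^sup>2 * norm (fcoeff F n u)) \<le> (2 * pi)\<^sup>2 * ((of_int n)\<^sup>2 * norm (fcoeff F n u))"
      by (intro mult_right_mono) auto
    ultimately have "(of_int n)\<^sup>2 * norm (fcoeff F n u) \<le> B" by (simp add: mult.assoc)
    with norm_fcoeff_le[OF assms A, of n u]
    have "norm (fcoeff F n u) * (1 + (of_int n)\<^sup>2) \<le> A + B" by (simp add: algebra_simps)
    moreover have "0 < 1 + (real_of_int n)\<^sup>2" by (rule add_pos_nonneg) auto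
    ultimately show ?thesis by (simp add: field_simps)
  qed
  then show ?thesis by (rule that)
qed

lemma summable_on_decay_weight: "decay_weight summable_on UNIV"
proof -
  have nat: "(\<lambda>n. decay_weight (int n)) summable_on UNIV"
  proof (rule norm_summable_imp_summable_on, rule summable_comparison_test')
    show "summable (\<lambda>n. inverse ((of_nat n :: real) ^ 2))" by (rule inverse_power_summable) simp
    show "norm (norm (decay_weight (int n))) \<le> inverse ((of_nat n) ^ 2)" if "n \<ge> 1" for n
      using that by (auto intro!: le_imp_inverse_le)
  qed
  have "decay_weight summable_on range int"
    using nat summable_on_reindex[of int UNIV decay_weight] by (simp add: o_def)
  moreover have "decay_weight summable_on range (\<lambda>n. - int n)"
    using nat summable_on_reindex[of "\<lambda>n. - int n" UNIV decay_weight]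
    by (simp add: o_def inj_on_def)
  ultimately have "decay_weight summable_on (range int \<union> range (\<lambda>n. - int n))"
    by (rule summable_on_union)
  moreover have "range int \<union> range (\<lambda>n. - int n) = UNIV"
  proof -
    have "x \<in> range int \<union> range (\<lambda>n. - int n)" for x
      by (cases x rule: int_cases2) auto
    then show ?thesis by blast
  qed
  ultimately show ?thesis by simp
qed

section \<open>Sums of second differences\<close>

text \<open>With a nonzero limit \<open>T\<close> the sequence would drift: from some
  \<open>N\<close> on, \<open>m\<close> steps move it by \<open>m * T\<close> up to an error of
  \<open>m * norm T / 2\<close>, which leaves every bounded set.\<close>

lemma tendsto_increments_of_bounded:
  fixes Q :: "nat \<Rightarrow> 'a :: real_normed_vector"
  assumes bdd: "\<And>n. norm (Q n) \<le> B" and lim: "(\<lambda>n. Q (Suc n) - Q n) \<longlonglongrightarrow> T"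
  shows "T = 0"
proof (rule ccontr)
  assume "T \<noteq> 0"
  then have "norm T / 2 > 0" by simp
  from LIMSEQ_D[OF lim this] obtain N where
    N: "\<And>n. n \<ge> N \<Longrightarrow> norm (Q (Suc n) - Q n - T) < norm T / 2" by blast
  have "norm (Q (N + m) - Q N - real m *\<^sub>R T) \<le> real m * (norm T / 2)" for m
  proof (induction m)
    case (Suc m)
    have "Q (N + Suc m) - Q N - real (Suc m) *\<^sub>R T
        = (Q (N + m) - Q N - real m *\<^sub>R T) + (Q (Suc (N + m)) - Q (N + m) - T)"
      by (simp add: algebra_simps)
    also have "norm \<dots> \<le> real m * (norm T / 2) + norm T / 2"
      by (rule norm_triangle_mono[OF Suc]) (use N[of "N + m"] in simp)
    finally show ?case by (simp add: algebra_simps)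
  qed simp
  then have "real m * norm T - real m * (norm T / 2) \<le> norm (Q (N + m) - Q N)" for m
    using norm_triangle_ineq2[of "real m *\<^sub>R T" "Q (N + m) - Q N"]
    by (smt (verit) norm_minus_commute norm_scaleR of_nat_0_le_iff abs_of_nonneg)
  moreover have "norm (Q (N + m) - Q N) \<le> B + B" for m
    by (rule order_trans[OF norm_triangle_ineq4]) (intro add_mono bdd)
  ultimately have "real m * (norm T / 2) \<le> B + B" for m
    by (smt (verit) field_sum_of_halves distrib_left)
  moreover obtain m where "B + B < real m * (norm T / 2)"
    using reals_Archimedean3[OF \<open>norm T / 2 > 0\<close>] by blast
  ultimately show False by (meson not_less)
qed

text \<open>The symmetric partial sums of the second differences are themselves the increments of
  a bounded sequence.\<close>

lemma has_sum_second_differences: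
  fixes k :: "int \<Rightarrow> complex"
  assumes "\<And>n. norm (k n) \<le> B" "(\<lambda>n. k n - 2 * k (n - 1) + k (n - 2)) summable_on UNIV"
  shows "((\<lambda>n. k n - 2 * k (n - 1) + k (n - 2)) has_sum 0) UNIV"
proof -
  define d where "d = (\<lambda>n. k n - 2 * k (n - 1) + k (n - 2))"
  \<comment> \<open>The window from \<open>- N\<close> to \<open>N\<close> telescopes to the
    difference of two first differences,
    \<open>(k N - k (N - 1)) - (k (- N - 1) - k (- N - 2))\<close>. Regrouped, these four values
    form an increment of \<open>Q\<close>.\<close>
  define Q where "Q = (\<lambda>N. k (int N - 1) + k (- int N - 1))"
  obtain T where T: "(d has_sum T) UNIV"
    using assms(2) unfolding d_def summable_on_def by blast
  have sum: "sum d {- int N..int N} = Q (Suc N) - Q N" for N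
  proof (induction N)
    case 0
    then show ?case by (simp add: d_def Q_def)
  next
    case (Suc N)
    have "{- int (Suc N)..int (Suc N)} = insert (int (Suc N)) (insert (- int (Suc N)) {- int N..int N})"
      by auto
    then have "sum d {- int (Suc N)..int (Suc N)}
        = d (int (Suc N)) + (d (- int (Suc N)) + sum d {- int N..int N})"
      by simp
    also have "\<dots> = Q (Suc (Suc N)) - Q (Suc N)"
      unfolding Suc by (simp add: d_def Q_def algebra_simps minus_diff_commute)
    finally show ?case .
  qed
  have "filterlim (\<lambda>N. - int N) at_bot sequentially"
    unfolding filterlim_at_bot
  proof
    fix Z :: int
    show "\<forall>\<^sub>F N in sequentially. - int N \<le> Z"
      by (rule eventually_sequentiallyI[of "nat (- Z)"]) linarith
  qed
  then have "filterlim (\<lambda>N. {- int N..int N}) (finite_subsets_at_top UNIV) sequentially"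
    by (intro filterlim_atLeastAtMost_at_bot_at_top filterlim_int_sequentially) auto
  with T have "(\<lambda>N. sum d {- int N..int N}) \<longlonglongrightarrow> T"
    unfolding has_sum_def by (rule filterlim_compose)
  moreover have "norm (Q N) \<le> B + B" for N
    unfolding Q_def by (rule order_trans[OF norm_triangle_ineq]) (intro add_mono assms)
  ultimately have "T = 0" unfolding sum by (intro tendsto_increments_of_bounded)
  with T show ?thesis by (simp add: d_def)
qed

section \<open>Division by the square of \<open>W t / W s - 1\<close>\<close>

text \<open>The right-hand side is the chord \<open>2 * \<bar>sin (pi * x)\<bar>\<close>, which has
  no zero but \<open>x = 0\<close> within half a period. The lower bound makes quadratic vanishing
  in \<open>x\<close> sufficient for division by the squared chord.\<close>

lemma abs_le_norm_W_minus_1: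
  assumes "\<bar>x\<bar> \<le> 1 / 2"
  shows "\<bar>x\<bar> \<le> norm (W x - 1)"
proof -
  have pos: "x \<le> norm (W x - 1)" if "0 \<le> x" "x \<le> 1 / 2" for x
  proof -
    \<comment> \<open>A quarter of the angle \<open>2 * pi * x\<close>. It stays within
      \<open>pi / 4\<close>, where the cosine is at least 1/2, so both factors of
      \<open>sin (2 * y) = 2 * sin y * cos y\<close> have simple lower bounds.\<close>
    define y where "y = pi * x / 2"
    have y: "0 \<le> y" "y \<le> pi / 4" using that by (auto simp: y_def)
    have c: "1 / 2 \<le> cos z" if "0 \<le> z" "z \<le> y" for z
    proof -
      have "cos (pi / 3) \<le> cos z" using that y by (intro cos_monotone_0_pi_le) auto
      then show ?thesis by (simp add: cos_60)
    qed
    have s: "y / 2 \<le> sin y"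
    proof (cases "y = 0")
      case False
      then obtain z where "0 < z" "z < y" "sin y - sin 0 = (y - 0) * cos z"
        using MVT2[of 0 y sin cos] y by auto
      then show ?thesis using mult_left_mono[OF c[of z], of y] y by simp
    qed simp
    have "norm (W x - 1) = 2 * \<bar>sin (2 * y)\<bar>"
      using dist_exp_i_1[of "2 * pi * x"] by (simp add: W_def y_def mult_ac)
    also have "\<dots> = 4 * (sin y * cos y)"
      using s c[of y] y by (simp add: sin_double abs_mult)
    also have "\<dots> \<ge> 4 * (y / 2 * (1 / 2))"
      using s c[of y] y by (intro mult_left_mono mult_mono) auto
    finally have "y \<le> norm (W x - 1)" by simp
    moreover have "x \<le> y"
      using pi_gt3 that mult_right_mono[of 2 pi x] by (simp add: y_def)
    ultimately show ?thesis by simp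
  qed
  have "norm (W (- x) - 1) = norm (W x - 1)"
  proof -
    have "W (- x) = cnj (W x)" by (simp add: W_def exp_cnj)
    then have "W (- x) - 1 = cnj (W x - 1)" by simp
    then show ?thesis by (metis complex_mod_cnj)
  qed
  then show ?thesis using pos[of x] pos[of "- x"] assms by (cases "x \<ge> 0") auto
qed

text \<open>The mean value inequality, applied to \<open>N1\<close> and then to \<open>N\<close> on
  a symmetric interval around \<open>s\<close>. Unlike the Lagrange remainder it is valid for
  vector-valued functions, at the cost of the factor 1/2.\<close>

lemma norm_le_square_of_second_derivative:
  fixes N :: "real \<Rightarrow> 'a :: real_normed_vector"
  assumes N: "\<And>t. (N has_vector_derivative N1 t) (at t)"
    and N1: "\<And>t. (N1 has_vector_derivative N2 t) (at t)"
    and bdd: "\<And>t. norm (N2 t) \<le> B" and zero: "N s = 0" "N1 s = 0"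
  shows "norm (N (s + x)) \<le> B * x\<^sup>2"
proof -
  have B: "0 \<le> B" using bdd[of 0] norm_ge_zero order_trans by blast
  have ons: "onorm (\<lambda>h. h *\<^sub>R v) \<le> C" if "norm v \<le> C" for v :: 'a and C
    using that by (intro onorm_le) (simp add: mult.commute[of C] mult_left_mono)
  have 1: "norm (N1 t) \<le> B * \<bar>t - s\<bar>" for t
    using differentiable_bound[of UNIV N1 "\<lambda>t h. h *\<^sub>R N2 t" B t s] N1 bdd ons zero
    by (auto simp: has_vector_derivative_def)
  have "norm (N (s + x) - N s) \<le> (B * \<bar>x\<bar>) * norm ((s + x) - s)"
  proof (rule differentiable_bound)
    show "convex {s - \<bar>x\<bar>..s + \<bar>x\<bar>}" by simp
    show "(N has_derivative (\<lambda>h. h *\<^sub>R N1 t)) (at t within {s - \<bar>x\<bar>..s + \<bar>x\<bar>})" for t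
      using N[of t] by (simp add: has_vector_derivative_def has_derivative_at_withinI)
    show "onorm (\<lambda>h. h *\<^sub>R N1 t) \<le> B * \<bar>x\<bar>" if "t \<in> {s - \<bar>x\<bar>..s + \<bar>x\<bar>}" for t
    proof (rule ons)
      have "\<bar>t - s\<bar> \<le> \<bar>x\<bar>" using that by auto
      then show "norm (N1 t) \<le> B * \<bar>x\<bar>"
        using 1[of t] B by (meson mult_left_mono order_trans)
    qed
  qed auto
  then show ?thesis by (simp add: zero power2_eq_square mult.assoc)
qed

lemma schwartz_cyl_periodic_int:
  assumes "F \<in> schwartz_cyl"
  shows "F (u, t + of_int n) = F (u, t)"
proof (induction n rule: int_induct[of _ 0])
  case base
  then show ?case by simp
next
  case (step1 i)
  then show ?case using schwartz_cyl_periodic[OF assms, of u "t + of_int i"] by (simp add: add_ac)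
next
  case (step2 i)
  then show ?case using schwartz_cyl_periodic[OF assms, of u "t + of_int (i - 1)"] by (simp add: add_ac)
qed

lemma W_of_int [simp]: "W (of_int n) = 1"
proof -
  have "W (of_int n) = W 1 powi n" by (subst W_powi) (simp add: W_def mult_ac)
  then show ?thesis by simp
qed

text \<open>Subtracting from \<open>F\<close> its trigonometric Taylor polynomial of degree one at \<open>s\<close> leaves a
  function that is divisible by \<open>(W t / W s - 1)\<^sup>2\<close> with bounded quotient \<open>H\<close>.\<close>

lemma fourier_second_order_quotient:
  assumes "F \<in> schwartz_cyl"
  obtains c H B where "\<And>t. F (u, t) = F (u, s) + c * (W t / W s - 1) + H t * (W t / W s - 1)\<^sup>2"
    "\<And>t :: real. norm (H t) \<le> B" "H \<in> borel_measurable borel"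
proof -
  obtain G where G: "G \<in> schwartz_cyl"
    "\<And>u t. ((\<lambda>t. F (u, t)) has_vector_derivative G (u, t)) (at t)"
    using schwartz_cyl_partial_t[OF assms] by metis
  obtain K where K: "K \<in> schwartz_cyl"
    "\<And>u t. ((\<lambda>t. G (u, t)) has_vector_derivative K (u, t)) (at t)"
    using schwartz_cyl_partial_t[OF G(1)] by metis
  obtain A where A: "\<And>z. norm (K z) \<le> A" by (rule schwartz_cyl_bounded[OF K(1)]) blast
  define e where "e = 2 * complex_of_real pi * \<i>"
  \<comment> \<open>The derivative of \<open>W t / W s\<close> at \<open>s\<close> is
    \<open>e\<close>, so this choice cancels the derivative of \<open>F\<close> there and
    \<open>N\<close> vanishes to second order.\<close>
  define c where "c = G (u, s) / e"
  define N where "N = (\<lambda>t. F (u, t) - F (u, s) - c * (W t / W s - 1))"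
  \<comment> \<open>Where \<open>W t = W s\<close> the quotient is 0 by the convention for division.
    \<open>H\<close> may jump there, so its integrability will come from measurability and
    boundedness instead of continuity.\<close>
  define H where "H = (\<lambda>t. N t / (W t / W s - 1)\<^sup>2)"
  have e: "e \<noteq> 0" by (simp add: e_def)
  have W: "(W has_vector_derivative e * W t) (at t)" for t
    using W_powi_has_vector_derivative[of 1 t UNIV] by (simp add: e_def)
  have N_le: "norm (N (s + x)) \<le> (A + norm (c * e\<^sup>2)) * x\<^sup>2" for x
  proof (rule norm_le_square_of_second_derivative)
    show "(N has_vector_derivative G (u, t) - c * (e * W t / W s)) (at t)" for t
      unfolding N_def
      by (rule has_vector_derivative_eq_rhs, (rule derivative_intros G W)+) (simp)
    show "((\<lambda>t. G (u, t) - c * (e * W t / W s)) has_vector_derivative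
        K (u, t) - c * (e * (e * W t) / W s)) (at t)" for t
      by (rule has_vector_derivative_eq_rhs, (rule derivative_intros K W)+) (simp)
    show "norm (K (u, t) - c * (e * (e * W t) / W s)) \<le> A + norm (c * e\<^sup>2)" for t
      by (rule order_trans[OF norm_triangle_ineq4])
        (use A[of "(u, t)"] in \<open>simp add: norm_mult norm_divide power2_eq_square\<close>)
    show "N s = 0" "G (u, s) - c * (e * W s / W s) = 0"
      using e by (simp_all add: N_def c_def)
  qed
  have B: "0 \<le> A + norm (c * e\<^sup>2)"
    using A[of "(0, 0)"] norm_ge_zero[of "K (0, 0)"]
    by (intro add_nonneg_nonneg norm_ge_zero) linarith
  \<comment> \<open>The quadratic bounds are useful only near \<open>s\<close>. Both numerator and
    denominator have period 1, so \<open>t\<close> can be moved to within 1/2 of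
    \<open>s\<close>.\<close>
  have reduce: "\<exists>x. \<bar>x\<bar> \<le> 1 / 2 \<and> N t = N (s + x) \<and> W t / W s = W x" for t
  proof (intro exI conjI)
    define x where "x = t - s - of_int (round (t - s))"
    show "\<bar>x\<bar> \<le> 1 / 2"
      using of_int_round_abs_le[of "t - s"] by (simp add: x_def abs_minus_commute)
    have t: "t = s + x + of_int (round (t - s))" by (simp add: x_def)
    have Wt: "W t = W (s + x)" by (subst t, subst W_add) simp
    have "F (u, t) = F (u, s + x)" by (subst t) (rule schwartz_cyl_periodic_int[OF assms])
    with Wt show "N t = N (s + x)" by (simp add: N_def)
    show "W t / W s = W x" by (simp add: Wt W_add)
  qed
  have H_le: "norm (H t) \<le> A + norm (c * e\<^sup>2)" for t
  proof -
    obtain x where x: "\<bar>x\<bar> \<le> 1 / 2" "N t = N (s + x)" "W t / W s = W x"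
      using reduce by blast
    have "norm (N t) \<le> (A + norm (c * e\<^sup>2)) * x\<^sup>2" unfolding x by (rule N_le)
    also have "\<dots> \<le> (A + norm (c * e\<^sup>2)) * (norm (W x - 1))\<^sup>2"
      using power_mono[OF abs_le_norm_W_minus_1[OF x(1)], of 2] B
      by (intro mult_left_mono) auto
    finally have "norm (N t) \<le> (A + norm (c * e\<^sup>2)) * (norm (W t / W s - 1))\<^sup>2"
      by (simp add: x)
    then show ?thesis
      using B by (cases "W t / W s = 1") (simp_all add: H_def norm_divide norm_power pos_divide_le_eq)
  qed
  have "N t = H t * (W t / W s - 1)\<^sup>2" for t
  proof (cases "W t / W s = 1")
    case True
    obtain x where x: "\<bar>x\<bar> \<le> 1 / 2" "N t = N (s + x)" "W t / W s = W x"
      using reduce by blast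
    then have "x = 0" using abs_le_norm_W_minus_1[OF x(1)] True by simp
    then have "N t = 0" using x by (simp add: N_def)
    with True show ?thesis by simp
  qed (simp add: H_def)
  then have "F (u, t) = F (u, s) + c * (W t / W s - 1) + H t * (W t / W s - 1)\<^sup>2" for t
    by (simp add: N_def algebra_simps)
  moreover have "H \<in> borel_measurable borel"
  proof -
    have [measurable]: "(\<lambda>t. F (u, t)) \<in> borel_measurable borel"
      by (intro borel_measurable_continuous_onI schwartz_cyl_continuous_on assms)
    have [measurable]: "W \<in> borel_measurable borel"
      unfolding W_def by (intro borel_measurable_continuous_onI continuous_intros)
    show ?thesis unfolding H_def N_def by measurable
  qed
  ultimately show ?thesis using H_le that by blast
qed

text \<open>Apart from the modes 0 and 1, which contribute \<open>F (u, s) - c\<close> and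
  \<open>c\<close>, the terms of the series are second differences of the bounded sequence
  \<open>k\<close>. Decay of the coefficients makes them summable and boundedness of
  \<open>k\<close> makes their sum zero. Taking the quotient to second order is what lets
  boundedness of the coefficients of \<open>H\<close> suffice.\<close>

lemma fourier_inversion:
  assumes "F \<in> schwartz_cyl"
  shows "((\<lambda>n. fcoeff F n u * W s powi n) has_sum F (u, s)) UNIV"
proof -
  obtain c H B where H: "\<And>t. F (u, t) = F (u, s) + c * (W t / W s - 1) + H t * (W t / W s - 1)\<^sup>2"
    "\<And>t :: real. norm (H t) \<le> B" "H \<in> borel_measurable borel"
    by (rule fourier_second_order_quotient[OF assms, of u s]) blast
  define w where "w = W s"
  have w: "w \<noteq> 0" "norm (w powi n) = 1" for n by (simp_all add: w_def)
  define I where "I = (\<lambda>n. integral {0..1} (\<lambda>t. H t * W t powi (- n)))"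
  have int: "(\<lambda>t. H t * W t powi (- n)) integrable_on {0..1}" for n
  proof (rule measurable_bounded_by_integrable_imp_integrable)
    have "W \<in> borel_measurable borel"
      unfolding W_def by (intro borel_measurable_continuous_onI continuous_intros)
    then have "(\<lambda>t. W t powi (- n)) \<in> borel_measurable borel"
      unfolding W_powi by (intro borel_measurable_continuous_onI continuous_intros)
    with H(3) have "(\<lambda>t. H t * W t powi (- n)) \<in> borel_measurable lebesgue"
      by (intro measurable_completion) simp
    then show "(\<lambda>t. H t * W t powi (- n)) \<in> borel_measurable (lebesgue_on {0..1})"
      by (rule measurable_restrict_space1)
    show "(\<lambda>_. B) integrable_on {0..1::real}" by (rule integrable_const_ivl)
    show "norm (H t * W t powi (- n)) \<le> B" for t using H(2) by (simp add: norm_mult)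
  qed simp
  have I_le: "norm (I n) \<le> B" for n
  proof -
    have "norm (I n) \<le> integral {0..1::real} (\<lambda>t. B)"
      unfolding I_def by (rule integral_norm_bound_integral) (auto simp: int H(2) norm_mult)
    then show ?thesis by simp
  qed
  \<comment> \<open>\<open>I n\<close> is a Fourier coefficient of \<open>H\<close>; the factor
    \<open>w powi n\<close> absorbs the powers of \<open>inverse w\<close> produced by
    \<open>(W t / w - 1)\<^sup>2\<close>, leaving a plain second difference.\<close>
  define k where "k = (\<lambda>n. I n * w powi n)"
  have coeff: "fcoeff F n u * w powi n =
      (k n - 2 * k (n - 1) + k (n - 2)) + (if n = 0 then F (u, s) - c else 0) + (if n = 1 then c else 0)"
    for n
  proof -
    have series: "((\<lambda>t. (F (u, s) - c) * W t powi (- n) + c * inverse w * W t powi (1 - n)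
          + (H t * W t powi (- n) - 2 * inverse w * (H t * W t powi (- (n - 1))) + (inverse w)\<^sup>2 * (H t * W t powi (- (n - 2)))))
        has_integral (F (u, s) - c) * (if - n = 0 then 1 else 0) + c * inverse w * (if 1 - n = 0 then 1 else 0)
          + (I n - 2 * inverse w * I (n - 1) + (inverse w)\<^sup>2 * I (n - 2))) {0..1}"
      unfolding I_def
      by (intro has_integral_add has_integral_diff has_integral_mult_right integrable_integral
          W_powi_has_integral int)
    have integrand: "(F (u, s) - c) * W t powi (- n) + c * inverse w * W t powi (1 - n)
          + (H t * W t powi (- n) - 2 * inverse w * (H t * W t powi (- (n - 1))) + (inverse w)\<^sup>2 * (H t * W t powi (- (n - 2))))
        = F (u, t) * W t powi (- n)" for t
    proof -
      have W_eqs: "W t powi (1 - n) = W t * W t powi (- n)" "W t powi (- (n - 1)) = W t * W t powi (- n)"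
        "W t powi (- (n - 2)) = W t ^ 2 * W t powi (- n)"
        using power_int_add[of "W t" 1 "- n"] power_int_add[of "W t" 2 "- n"] by simp_all
      have ring: "(a - c) * v + c * i * (z * v) + (x * v - 2 * i * (x * (z * v)) + i\<^sup>2 * (x * (z\<^sup>2 * v)))
          = (a + c * (z * i - 1) + x * (z * i - 1)\<^sup>2) * v" for a i v x z :: complex
        by algebra
      show ?thesis
        unfolding H(1)[of t] w_def[symmetric] divide_inverse W_eqs by (rule ring)
    qed
    have Fn: "fcoeff F n u = (F (u, s) - c) * (if n = 0 then 1 else 0) + c * inverse w * (if n = 1 then 1 else 0)
          + (I n - 2 * inverse w * I (n - 1) + (inverse w)\<^sup>2 * I (n - 2))"
      using integral_unique[OF series[unfolded integrand]]
      unfolding fcoeff_def by (cases "n = 0"; cases "n = 1") simp_all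
    have w_eqs: "w powi (n - 1) = inverse w * w powi n" "w powi (n - 2) = (inverse w)\<^sup>2 * w powi n"
      using power_int_diff[of w n 1] power_int_diff[of w n 2] w(1)
      by (simp_all add: divide_inverse power_inverse mult.commute)
    show ?thesis
      unfolding Fn k_def w_eqs
      using w(1) by (cases "n = 0"; cases "n = 1") (simp_all add: algebra_simps)
  qed
  obtain C where C: "\<And>n u. norm (fcoeff F n u) \<le> C * decay_weight n"
    by (rule fcoeff_decay[OF assms]) blast
  have "(\<lambda>n. norm (fcoeff F n u * w powi n)) summable_on UNIV"
    by (rule Infinite_Sum.abs_summable_on_comparison_test'[OF summable_on_cmult_right[OF summable_on_decay_weight, of C]])
      (simp add: norm_mult w C)
  then have "(\<lambda>n. fcoeff F n u * w powi n) summable_on UNIV" by (rule abs_summable_summable)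
  moreover have delta: "((\<lambda>n. if n = m then x else 0) has_sum x) UNIV" for m :: int and x :: complex
    by (rule has_sum_finite_neutralI[of "{m}"]) auto
  ultimately have "(\<lambda>n. fcoeff F n u * w powi n + (if n = 0 then - (F (u, s) - c) else 0)
      + (if n = 1 then - c else 0)) summable_on UNIV"
    by (intro summable_on_add) (auto intro: has_sum_imp_summable)
  also have "(\<lambda>n. fcoeff F n u * w powi n + (if n = 0 then - (F (u, s) - c) else 0)
      + (if n = 1 then - c else 0)) = (\<lambda>n. k n - 2 * k (n - 1) + k (n - 2))"
    by (auto simp: coeff fun_eq_iff)
  finally have "(\<lambda>n. k n - 2 * k (n - 1) + k (n - 2)) summable_on UNIV" .
  then have "((\<lambda>n. k n - 2 * k (n - 1) + k (n - 2)) has_sum 0) UNIV"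
    by (intro has_sum_second_differences[of _ B]) (simp_all add: k_def norm_mult w I_le)
  from has_sum_add[OF has_sum_add[OF this delta[of 0 "F (u, s) - c"]] delta[of 1 c]]
  show ?thesis unfolding coeff[symmetric] by (simp add: w_def)
qed

section \<open>The product on Schwartz functions\<close>

text \<open>With \<open>k\<close> outside, each sum over \<open>n\<close> is a translate of the full
  weight sum, hence the same constant times the weight of \<open>k\<close>. The final swap restores
  the order in which \<open>cmult\<close> sums.\<close>

lemma decay_convolution_summable:
  "(\<lambda>(n, k). decay_weight k * decay_weight (n - k)) summable_on UNIV \<times> UNIV"
proof -
  have shift: "((\<lambda>n. decay_weight (n - k)) has_sum infsum decay_weight UNIV) UNIV" for k
  proof -
    have "bij_betw (\<lambda>n. n - k) UNIV UNIV"
      by (rule bij_betw_byWitness[of _ "\<lambda>n. n + k"]) auto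
    from has_sum_reindex_bij_betw[OF this, of decay_weight] show ?thesis
      using summable_on_decay_weight by simp
  qed
  have "(\<lambda>(k, n). decay_weight k * decay_weight (n - k)) summable_on UNIV \<times> UNIV"
  proof (rule summable_on_SigmaI)
    show "((\<lambda>n. case (k, n) of (k, n) \<Rightarrow> decay_weight k * decay_weight (n - k))
        has_sum decay_weight k * infsum decay_weight UNIV) UNIV" for k
      using has_sum_cmult_right[OF shift[of k], of "decay_weight k"] by simp
    show "(\<lambda>k. decay_weight k * infsum decay_weight UNIV) summable_on UNIV"
      by (intro summable_on_cmult_left summable_on_decay_weight)
    show "0 \<le> (case (k, n) of (k, n) \<Rightarrow> decay_weight k * decay_weight (n - k))" for k n
      by simp
  qed
  then show ?thesis by (subst summable_on_swap) simp
qed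

text \<open>An infinite sum of a family that is not summable is 0 by convention, so additivity of
  \<open>cmult\<close> requires genuine summability of the inner and of the outer sum. Both follow
  from absolute summability over pairs.\<close>

lemma cmult_summable:
  assumes "F \<in> schwartz_cyl" "G \<in> schwartz_cyl"
  shows "(\<lambda>k. fcoeff F k u * fcoeff G (n - k) (u + of_int k * h)) summable_on UNIV"
    and "(\<lambda>n. (\<Sum>\<^sub>\<infinity>k. fcoeff F k u * fcoeff G (n - k) (u + of_int k * h)) * W t powi n) summable_on UNIV"
proof -
  obtain A where A: "\<And>n u. norm (fcoeff F n u) \<le> A * decay_weight n"
    by (rule fcoeff_decay[OF assms(1)]) blast
  obtain B where B: "\<And>n u. norm (fcoeff G n u) \<le> B * decay_weight n"
    by (rule fcoeff_decay[OF assms(2)]) blast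
  have A0: "0 \<le> A" using order_trans[OF norm_ge_zero A[of 0 0]] by simp
  define f where "f = (\<lambda>(n, k). fcoeff F k u * fcoeff G (n - k) (u + of_int k * h) * W t powi n)"
  have "(\<lambda>z. norm (f z)) summable_on UNIV \<times> UNIV"
  proof (rule Infinite_Sum.abs_summable_on_comparison_test')
    show "(\<lambda>z. (A * B) * (case z of (n, k) \<Rightarrow> decay_weight k * decay_weight (n - k))) summable_on UNIV \<times> UNIV"
      by (intro summable_on_cmult_right decay_convolution_summable)
    fix z :: "int \<times> int"
    obtain n k where z: "z = (n, k)" by (cases z)
    have "norm (fcoeff F k u) * norm (fcoeff G (n - k) (u + of_int k * h))
        \<le> (A * decay_weight k) * (B * decay_weight (n - k))"
      using A0 by (intro mult_mono A B) auto
    then show "norm (f z) \<le> (A * B) * (case z of (n, k) \<Rightarrow> decay_weight k * decay_weight (n - k))"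
      by (simp add: f_def z norm_mult mult_ac)
  qed
  then have sum: "f summable_on UNIV \<times> UNIV" by (rule abs_summable_summable)
  have "(\<lambda>k. f (n, k)) summable_on UNIV"
    using sum by (rule summable_on_SigmaD1[where f = "\<lambda>n k. f (n, k)", simplified case_prod_eta]) simp
  \<comment> \<open>\<open>f\<close> carries the nonzero factor \<open>W t powi n\<close>; dividing
    by it leaves the coefficient sum.\<close>
  from summable_on_cmult_left[OF this, of "inverse (W t powi n)"]
  show "(\<lambda>k. fcoeff F k u * fcoeff G (n - k) (u + of_int k * h)) summable_on UNIV"
    by (simp add: f_def mult.assoc)
  from summable_on_Sigma_banach[where f = "\<lambda>n k. f (n, k)", simplified case_prod_eta, OF sum]
  show "(\<lambda>n. (\<Sum>\<^sub>\<infinity>k. fcoeff F k u * fcoeff G (n - k) (u + of_int k * h)) * W t powi n) summable_on UNIV"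
    by (simp add: f_def infsum_cmult_left')
qed

lemma cmult_add_left:
  assumes "F \<in> schwartz_cyl" "G \<in> schwartz_cyl" "A \<in> schwartz_cyl"
  shows "cmult h (\<lambda>z. F z + G z) A = (\<lambda>z. cmult h F A z + cmult h G A z)"
  unfolding cmult_def
  by (auto simp: fun_eq_iff fcoeff_add assms distrib_right infsum_add cmult_summable)

text \<open>Left multiplication by \<open>W\<^bsup>-N\<^esup>\<close>, a multiplier that is not itself in the algebra.\<close>

definition W_shift :: "real \<Rightarrow> int \<Rightarrow> (real \<times> real \<Rightarrow> complex) \<Rightarrow> real \<times> real \<Rightarrow> complex" where
  "W_shift h N F = (\<lambda>(u, t). W t powi (- N) * F (u - of_int N * h, t))"

lemma schwartz_cyl_W_shift:
  assumes "F \<in> schwartz_cyl"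
  shows "W_shift h N F \<in> schwartz_cyl"
  using schwartz_cyl_mult_W_powi[OF schwartz_cyl_shift[OF assms, of "- (of_int N * h)"], of "- N"]
  by (simp add: W_shift_def case_prod_beta')

lemma W_shift_W_shift: "W_shift h M (W_shift h N F) = W_shift h (M + N) F"
proof -
  have "W t powi (- (M + N)) = W t powi (- M) * W t powi (- N)" for t
    using power_int_add[of "W t" "- M" "- N"] by simp
  then show ?thesis by (auto simp: W_shift_def fun_eq_iff algebra_simps)
qed

lemma W_shift_0: "W_shift h 0 F = F"
  by (auto simp: W_shift_def)

lemma W_shift_inverse: "W_shift h N (W_shift h (- N) F) = F" "W_shift h (- N) (W_shift h N F) = F"
  by (simp_all add: W_shift_W_shift W_shift_0)

lemma W_shift_add: "W_shift h N (\<lambda>z. F z + G z) = (\<lambda>z. W_shift h N F z + W_shift h N G z)"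
  by (auto simp: W_shift_def fun_eq_iff algebra_simps)

lemma W_shift_scale: "W_shift h N (\<lambda>z. c * F z) = (\<lambda>z. c * W_shift h N F z)"
  by (auto simp: W_shift_def fun_eq_iff)

lemma fcoeff_W_shift: "fcoeff (W_shift h N F) k u = fcoeff F (k + N) (u - of_int N * h)"
proof -
  have "W t powi (- (k + N)) = W t powi (- N) * W t powi (- k)" for t
    using power_int_add[of "W t" "- N" "- k"] by (simp add: add.commute)
  then show ?thesis by (simp add: fcoeff_def W_shift_def mult_ac)
qed

lemma bij_int_add: "bij_betw (\<lambda>n::int. n + N) UNIV UNIV"
  by (rule bij_betw_byWitness[of _ "\<lambda>n. n - N"]) auto

text \<open>Associativity with a power of \<open>W\<close> as the leftmost factor: both sums are
  only reindexed by \<open>N\<close>, an operation valid for arbitrary families. It makes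
  \<open>W_shift\<close> a map of right modules.\<close>

lemma cmult_W_shift: "cmult h (W_shift h N F) A = W_shift h N (cmult h F A)"
proof (intro ext, clarify)
  fix u t
  define v where "v = u - of_int N * h"
  define c where "c = (\<lambda>m. \<Sum>\<^sub>\<infinity>j. fcoeff F j v * fcoeff A (m - j) (v + of_int j * h))"
  have inner: "(\<Sum>\<^sub>\<infinity>k. fcoeff (W_shift h N F) k u * fcoeff A (n - k) (u + of_int k * h)) = c (n + N)" for n
    unfolding c_def fcoeff_W_shift v_def
    by (subst infsum_reindex_bij_betw[OF bij_int_add[of N], symmetric]) (simp add: algebra_simps)
  have "cmult h (W_shift h N F) A (u, t) = (\<Sum>\<^sub>\<infinity>n. c (n + N) * W t powi n)"
    by (simp add: cmult_def inner)
  also have "\<dots> = (\<Sum>\<^sub>\<infinity>n. W t powi (- N) * (c (n + N) * W t powi (n + N)))"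
    by (intro infsum_cong) (simp add: power_int_add power_int_minus)
  also have "\<dots> = W t powi (- N) * (\<Sum>\<^sub>\<infinity>n. c (n + N) * W t powi (n + N))"
    by (rule infsum_cmult_right')
  also have "(\<Sum>\<^sub>\<infinity>n. c (n + N) * W t powi (n + N)) = (\<Sum>\<^sub>\<infinity>m. c m * W t powi m)"
    by (rule infsum_reindex_bij_betw[OF bij_int_add])
  also have "W t powi (- N) * \<dots> = W_shift h N (cmult h F A) (u, t)"
    by (simp add: W_shift_def cmult_def c_def v_def)
  finally show "cmult h (W_shift h N F) A (u, t) = W_shift h N (cmult h F A) (u, t)" .
qed

text \<open>Moving \<open>W\<close> past \<open>F\<close> shifts \<open>u\<close> by
  \<open>h\<close>, whence the arguments \<open>u + h\<close> and \<open>u - h\<close>. The formula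
  applies to arbitrary functions, so such operators compose without convergence questions.\<close>

definition tridiag :: "real \<Rightarrow> (real \<Rightarrow> real) \<Rightarrow> (real \<Rightarrow> real) \<Rightarrow> (real \<times> real \<Rightarrow> complex)
    \<Rightarrow> real \<times> real \<Rightarrow> complex" where
  "tridiag h f g F = (\<lambda>(u, t). of_real (g (u + h)) * W t * F (u + h, t) + of_real (f u) * F (u, t)
     + of_real (g u) * inverse (W t) * F (u - h, t))"

lemma fcoeff_trig_poly:
  "fcoeff (\<lambda>(u, t). a u * W t + b u + c u * inverse (W t)) k u
     = (if k = 1 then a u else if k = 0 then b u else if k = - 1 then c u else 0)"
proof -
  have "((\<lambda>t. a u * W t powi (1 - k) + b u * W t powi (- k) + c u * W t powi (- 1 - k)) has_integral
      (a u * (if 1 - k = 0 then 1 else 0) + b u * (if - k = 0 then 1 else 0)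
        + c u * (if - 1 - k = 0 then 1 else 0))) {0..1}"
    by (intro has_integral_add has_integral_mult_right W_powi_has_integral)
  moreover have "a u * W t powi (1 - k) + b u * W t powi (- k) + c u * W t powi (- 1 - k)
      = (a u * W t + b u + c u * inverse (W t)) * W t powi (- k)" for t
    using power_int_add[of "W t" 1 "- k"] power_int_add[of "W t" "- 1" "- k"]
    by (simp add: algebra_simps power_int_minus)
  ultimately show ?thesis
    unfolding fcoeff_def by (auto dest!: integral_unique split: if_splits)
qed

text \<open>The left factor has three Fourier modes, so the inner sum is finite. The outer one
  splits into three index-shifted Fourier series of \<open>F\<close>, at \<open>u + h\<close>,
  \<open>u\<close> and \<open>u - h\<close>.\<close>

lemma cmult_tridiag:
  assumes "F \<in> schwartz_cyl"
  shows "cmult h (\<lambda>(u, t). of_real (g (u + h)) * W t + of_real (f u) + of_real (g u) * inverse (W t)) F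
    = tridiag h f g F"
proof (intro ext, clarify)
  fix u t
  define p :: "real \<times> real \<Rightarrow> complex" where
    "p = (\<lambda>(u, t). of_real (g (u + h)) * W t + of_real (f u) + of_real (g u) * inverse (W t))"
  define c :: "int \<Rightarrow> complex" where "c = (\<lambda>n. of_real (g (u + h)) * fcoeff F (n + - 1) (u + h)
      + of_real (f u) * fcoeff F n u + of_real (g u) * fcoeff F (n + 1) (u - h))"
  have fcoeff_p: "fcoeff p k u = (if k = 1 then of_real (g (u + h)) else if k = 0 then of_real (f u)
      else if k = - 1 then of_real (g u) else 0)" for k
    unfolding p_def by (rule fcoeff_trig_poly)
  have "((\<lambda>k. fcoeff p k u * fcoeff F (n - k) (u + of_int k * h)) has_sum c n) UNIV" for n
    by (rule has_sum_finite_neutralI[of "{- 1, 0, 1}"])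
      (auto simp: c_def fcoeff_p algebra_simps)
  then have inner: "(\<Sum>\<^sub>\<infinity>k. fcoeff p k u * fcoeff F (n - k) (u + of_int k * h)) = c n" for n
    by (rule infsumI)
  have shifted: "((\<lambda>n. fcoeff F (n + N) v * W t powi (n + N)) has_sum F (v, t)) UNIV" for N v
    using has_sum_reindex_bij_betw[OF bij_int_add, of "\<lambda>n. fcoeff F n v * W t powi n"]
      fourier_inversion[OF assms] by simp
  have "((\<lambda>n. of_real (g (u + h)) * W t * (fcoeff F (n + - 1) (u + h) * W t powi (n + - 1))
      + of_real (f u) * (fcoeff F (n + 0) u * W t powi (n + 0))
      + of_real (g u) * inverse (W t) * (fcoeff F (n + 1) (u - h) * W t powi (n + 1)))
      has_sum tridiag h f g F (u, t)) UNIV"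
    unfolding tridiag_def prod.case
    by (intro has_sum_add has_sum_cmult_right shifted)
  also have "(\<lambda>n. of_real (g (u + h)) * W t * (fcoeff F (n + - 1) (u + h) * W t powi (n + - 1))
      + of_real (f u) * (fcoeff F (n + 0) u * W t powi (n + 0))
      + of_real (g u) * inverse (W t) * (fcoeff F (n + 1) (u - h) * W t powi (n + 1)))
      = (\<lambda>n. c n * W t powi n)"
  proof
    fix n
    have ring: "a * w * (x * p) + b * (y * v) + d * i * (z * q) = (a * x + b * y + d * z) * v"
      if "w * p = v" "i * q = v" for a b d i p q v w x y z :: complex
    proof -
      have "a * w * (x * p) + b * (y * v) + d * i * (z * q) = a * x * (w * p) + b * y * v + d * z * (i * q)"
        by (simp add: mult_ac)
      then show ?thesis unfolding that by (simp add: distrib_right)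
    qed
    have "W t * W t powi (n + - 1) = W t powi n" "inverse (W t) * W t powi (n + 1) = W t powi n"
      using power_int_add[of "W t" n "- 1"] power_int_add[of "W t" n 1]
      by (simp_all add: power_int_minus)
    then show "of_real (g (u + h)) * W t * (fcoeff F (n + - 1) (u + h) * W t powi (n + - 1))
      + of_real (f u) * (fcoeff F (n + 0) u * W t powi (n + 0))
      + of_real (g u) * inverse (W t) * (fcoeff F (n + 1) (u - h) * W t powi (n + 1)) = c n * W t powi n"
      unfolding c_def add_0_right by (rule ring)
  qed
  finally have "((\<lambda>n. c n * W t powi n) has_sum tridiag h f g F (u, t)) UNIV" .
  then show "cmult h p F (u, t) = tridiag h f g F (u, t)"
    unfolding cmult_def prod.case inner by (rule infsumI)
qed

section \<open>The projections\<close>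

text \<open>The floor selects the cell containing \<open>u\<close>, so only one translate of
  \<open>b\<close> is ever evaluated. Indexing by sets of integers lets cells be intersected, joined
  and translated.\<close>

definition spread :: "real \<Rightarrow> (real \<Rightarrow> real) \<Rightarrow> int set \<Rightarrow> real \<Rightarrow> real" where
  "spread h b S u = (if \<lfloor>u / (2 * h)\<rfloor> \<in> S then b (u - 2 * of_int \<lfloor>u / (2 * h)\<rfloor> * h) else 0)"

lemma floor_cell:
  assumes "0 \<le> v" "v < 2 * h"
  shows "\<lfloor>(2 * of_int q * h + v) / (2 * h)\<rfloor> = q"
  using assms by (intro floor_unique) (auto simp: field_simps)

lemma spread_cell:
  assumes "0 \<le> v" "v < 2 * h"
  shows "spread h b S (2 * of_int q * h + v) = (if q \<in> S then b v else 0)"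
  using floor_cell[OF assms] by (simp add: spread_def)

lemma cell_exhaust:
  assumes "h > (0::real)"
  obtains q v where "u = 2 * of_int q * h + v" "0 \<le> v" "v < 2 * h"
proof -
  have h2: "0 < 2 * h" using assms by simp
  have "of_int \<lfloor>u / (2 * h)\<rfloor> * (2 * h) \<le> u"
    by (rule iffD1[OF pos_le_divide_eq[OF h2] of_int_floor_le])
  moreover have "u < (of_int \<lfloor>u / (2 * h)\<rfloor> + 1) * (2 * h)"
    by (rule iffD1[OF pos_divide_less_eq[OF h2]]) linarith
  ultimately have "0 \<le> u - 2 * of_int \<lfloor>u / (2 * h)\<rfloor> * h" "u - 2 * of_int \<lfloor>u / (2 * h)\<rfloor> * h < 2 * h"
    by (simp_all add: algebra_simps)
  from that[of "\<lfloor>u / (2 * h)\<rfloor>", OF _ this] show ?thesis by simp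
qed

text \<open>Closed cells meet only in end points, where \<open>b\<close> vanishes; hence only the
  translate belonging to the cell of \<open>u\<close> can contribute.\<close>

lemma sum_translates_eq_spread:
  assumes "h > 0" and supp: "\<And>x. x \<le> 0 \<or> x \<ge> 2 * h \<Longrightarrow> b x = 0"
  shows "(\<Sum>k = 1..j. b (u - 2 * real k * h)) = spread h b {1..int j} u"
proof -
  obtain q v where u: "u = 2 * of_int q * h + v" "0 \<le> v" "v < 2 * h"
    by (rule cell_exhaust[OF assms(1)])
  have "b (u - 2 * real k * h) = (if int k = q then b v else 0)" for k
  proof -
    define m where "m = real_of_int (q - int k)"
    have eq: "u - 2 * real k * h = 2 * (m * h) + v" by (simp add: u m_def algebra_simps)
    consider "int k = q" | "int k \<noteq> q" "1 \<le> m" | "int k \<noteq> q" "m \<le> - 1"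
      unfolding m_def by linarith
    then show ?thesis
    proof cases
      case 1
      then show ?thesis by (simp add: eq m_def)
    next
      case 2
      then have "1 * h \<le> m * h" using assms(1) by (intro mult_right_mono) auto
      then have "b (2 * (m * h) + v) = 0" using u by (intro supp) linarith
      with 2 show ?thesis by (simp add: eq)
    next
      case 3
      then have "m * h \<le> - 1 * h" using assms(1) by (intro mult_right_mono) auto
      then have "b (2 * (m * h) + v) = 0" using u by (intro supp) linarith
      with 3 show ?thesis by (simp add: eq)
    qed
  qed
  then have "(\<Sum>k = 1..j. b (u - 2 * real k * h)) = (\<Sum>k = 1..j. if int k = q then b v else 0)"
    by simp
  also have "\<dots> = (if q \<in> {1..int j} then b v else 0)"
  proof (cases "q \<in> {1..int j}")
    case True
    then have "(\<Sum>k = 1..j. if int k = q then b v else 0) = (\<Sum>k = 1..j. if k = nat q then b v else 0)"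
      by (intro sum.cong) auto
    with True show ?thesis by (auto simp: nat_le_iff)
  qed (auto intro!: sum.neutral)
  also have "\<dots> = spread h b {1..int j} u"
    unfolding u(1) by (simp only: spread_cell[OF u(2,3)])
  finally show ?thesis .
qed

section \<open>Values on half cells and products of cell projections\<close>

locale profile =
  fixes h :: real and \<phi> :: "real \<Rightarrow> real"
  assumes h_pos: "h > 0" and admissible: "admissible_profile h \<phi>"
begin

abbreviation f_on :: "int set \<Rightarrow> real \<Rightarrow> real" where "f_on \<equiv> spread h (f_fun h \<phi>)"
abbreviation g_on :: "int set \<Rightarrow> real \<Rightarrow> real" where "g_on \<equiv> spread h (g_fun h \<phi>)"

text \<open>The operator of left multiplication by the projection supported on the cells
  \<open>[2 q h, 2 (q + 1) h]\<close> with \<open>q \<in> S\<close>.\<close>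

definition proj_op :: "int set \<Rightarrow> (real \<times> real \<Rightarrow> complex) \<Rightarrow> real \<times> real \<Rightarrow> complex" where
  "proj_op S = tridiag h (f_on S) (g_on S)"

lemma profile_range: "0 \<le> x \<Longrightarrow> x \<le> h \<Longrightarrow> 0 \<le> \<phi> x \<and> \<phi> x \<le> 1"
  and profile_0: "\<phi> 0 = 0" and profile_h: "\<phi> h = 1"
  using admissible h_pos mono_onD[of "{0..h}" \<phi> 0 x] mono_onD[of "{0..h}" \<phi> x h]
  by (auto simp: admissible_profile_def)

lemma f_fun_supp: "x \<le> 0 \<or> x \<ge> 2 * h \<Longrightarrow> f_fun h \<phi> x = 0"
  by (auto simp: f_fun_def)

lemma g_fun_supp: "x \<le> 0 \<or> x \<ge> 2 * h \<Longrightarrow> g_fun h \<phi> x = 0"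
  using h_pos by (auto simp: g_fun_def)

lemma f_fun_lower: "0 \<le> v \<Longrightarrow> v < h \<Longrightarrow> f_fun h \<phi> v = \<phi> v"
  using h_pos by (auto simp: f_fun_def profile_0)

lemma f_fun_upper: "0 \<le> v \<Longrightarrow> v < h \<Longrightarrow> f_fun h \<phi> (v + h) = 1 - \<phi> v"
  \<comment> \<open>For \<open>v = 0\<close> the argument \<open>h\<close> falls into the first
    branch of \<open>f_fun\<close>, whose value \<open>\<phi> h = 1\<close> agrees with
    \<open>1 - \<phi> 0\<close>.\<close>
  using h_pos by (cases "v = 0") (auto simp: f_fun_def profile_0 profile_h)

lemma g_fun_lower: "v \<le> h \<Longrightarrow> g_fun h \<phi> v = 0"
  by (simp add: g_fun_def)

text \<open>The expression \<open>x - x\<^sup>2\<close> is invariant under replacing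
  \<open>x\<close> by \<open>1 - x\<close>, so the square of \<open>g_fun\<close> is expressed by
  \<open>\<phi> v\<close> itself; that \<open>\<phi>\<close> takes values in \<open>[0, 1]\<close>
  makes the radicand nonnegative.\<close>

lemma g_fun_upper:
  assumes "0 \<le> v" "v < h"
  shows "(g_fun h \<phi> (v + h))\<^sup>2 = \<phi> v - (\<phi> v)\<^sup>2"
proof (cases "v = 0")
  case True
  then show ?thesis by (simp add: g_fun_def profile_0)
next
  case False
  have "(1 - \<phi> v) - (1 - \<phi> v)\<^sup>2 = \<phi> v * (1 - \<phi> v)" by (simp add: power2_eq_square algebra_simps)
  also have "\<dots> \<ge> 0" using profile_range[of v] assms by (intro mult_nonneg_nonneg) auto
  finally have "0 \<le> (1 - \<phi> v) - (1 - \<phi> v)\<^sup>2" .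
  then have "(g_fun h \<phi> (v + h))\<^sup>2 = (1 - \<phi> v) - (1 - \<phi> v)\<^sup>2"
    using False assms by (simp add: g_fun_def f_fun_upper)
  then show ?thesis by (simp add: power2_eq_square algebra_simps)
qed

text \<open>Everything the projections depend on at \<open>u\<close>: the same \<open>q\<close>,
  \<open>p\<close> and \<open>r\<close> serve for all sets \<open>S\<close>. Split at the middle of
  the cell, exactly one of \<open>g_on S u\<close> and \<open>g_on S (u + h)\<close> is forced to
  vanish, and the values left belong to cell \<open>q\<close>.\<close>

lemma cell_values:
  obtains (lower) q p r where "r\<^sup>2 = p - p\<^sup>2"
    "\<And>S. f_on S u = (if q \<in> S then p else 0)" "\<And>S. g_on S u = 0"
    "\<And>S. g_on S (u + h) = (if q \<in> S then r else 0)"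
  | (upper) q p r where "r\<^sup>2 = p - p\<^sup>2"
    "\<And>S. f_on S u = (if q \<in> S then 1 - p else 0)" "\<And>S. g_on S u = (if q \<in> S then r else 0)"
    "\<And>S. f_on S (u - h) = (if q \<in> S then p else 0)" "\<And>S. g_on S (u + h) = 0"
proof -
  obtain q v where u: "u = 2 * of_int q * h + v" "0 \<le> v" "v < 2 * h"
    by (rule cell_exhaust[OF h_pos])
  show ?thesis
  proof (cases "v < h")
    case True
    have uh: "u + h = 2 * of_int q * h + (v + h)" by (simp add: u)
    show ?thesis
    proof (rule lower)
      show "(g_fun h \<phi> (v + h))\<^sup>2 = \<phi> v - (\<phi> v)\<^sup>2" using True u by (intro g_fun_upper)
      show "f_on S u = (if q \<in> S then \<phi> v else 0)" for S
        unfolding u(1) using True u by (simp only: spread_cell f_fun_lower)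
      show "g_on S u = 0" for S
        unfolding u(1) using True u by (simp add: spread_cell g_fun_lower)
      show "g_on S (u + h) = (if q \<in> S then g_fun h \<phi> (v + h) else 0)" for S
        unfolding uh using True u by (intro spread_cell) auto
    qed
  next
    case False
    have u': "u = 2 * of_int q * h + ((v - h) + h)" by (simp add: u)
    \<comment> \<open>From the upper half, \<open>u + h\<close> enters the lower half of the next
      cell, where \<open>g_fun\<close> is zero, while \<open>u - h\<close> stays in cell
      \<open>q\<close>.\<close>
    have uh: "u + h = 2 * of_int (q + 1) * h + (v - h)" "u - h = 2 * of_int q * h + (v - h)"
      by (simp_all add: u algebra_simps)
    have v: "0 \<le> v - h" "v - h < h" using False u by auto
    have v': "0 \<le> v - h" "v - h < 2 * h" "0 \<le> (v - h) + h" "(v - h) + h < 2 * h"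
      using v h_pos by auto
    show ?thesis
    proof (rule upper)
      show "(g_fun h \<phi> ((v - h) + h))\<^sup>2 = \<phi> (v - h) - (\<phi> (v - h))\<^sup>2" by (rule g_fun_upper[OF v])
      show "f_on S u = (if q \<in> S then 1 - \<phi> (v - h) else 0)" for S
        unfolding u' by (simp only: spread_cell[OF v'(3,4)] f_fun_upper[OF v])
      show "g_on S u = (if q \<in> S then g_fun h \<phi> ((v - h) + h) else 0)" for S
        unfolding u' by (rule spread_cell[OF v'(3,4)])
      show "f_on S (u - h) = (if q \<in> S then \<phi> (v - h) else 0)" for S
        unfolding uh by (simp only: spread_cell[OF v'(1,2)] f_fun_lower[OF v])
      show "g_on S (u + h) = 0" for S
        unfolding uh by (subst spread_cell[OF v'(1,2)]) (use v in \<open>simp add: g_fun_lower\<close>)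
    qed
  qed
qed

text \<open>Removes the terms in \<open>W\<close> to the powers 2 and -2 from a composition.\<close>

lemma g_on_g_on: "g_on S u * g_on T (u + h) = 0"
  by (cases u rule: cell_values) simp_all

text \<open>The coefficients of \<open>W\<close> and of its inverse in a composition: where
  \<open>g_on\<close> is nonzero, \<open>f_fun\<close> at \<open>u\<close> and at
  \<open>u - h\<close> have the values \<open>1 - p\<close> and \<open>p\<close>, which add up to
  1.\<close>

lemma f_on_g_on:
  "g_on S u * f_on T u + f_on S (u - h) * g_on T u = g_on (S \<inter> T) u"
  "f_on S u * g_on T u + g_on S u * f_on T (u - h) = g_on (S \<inter> T) u"
  by (cases u rule: cell_values; simp add: algebra_simps)+

text \<open>The constant coefficient of a composition: \<open>r\<^sup>2 = p - p\<^sup>2\<close>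
  completes \<open>p\<^sup>2\<close> to \<open>p\<close> on the lower half and
  \<open>(1 - p)\<^sup>2\<close> to \<open>1 - p\<close> on the upper half.\<close>

lemma f_on_f_on:
  "g_on S (u + h) * g_on T (u + h) + f_on S u * f_on T u + g_on S u * g_on T u = f_on (S \<inter> T) u"
  by (cases u rule: cell_values) (auto simp: power2_eq_square algebra_simps)

lemma proj_op_proj_op: "proj_op S (proj_op T F) = proj_op (S \<inter> T) F"
proof (intro ext, clarify)
  fix u t
  let ?c = "complex_of_real"
  define w where "w = W t"
  define i where "i = inverse w"
  have wi: "w * i = 1" by (simp add: w_def i_def)
  have 1: "?c (g_on S (u + h)) * ?c (g_on T (u + h + h)) = 0"
    using g_on_g_on[of S "u + h" T] by (metis of_real_0 of_real_mult)
  have 2: "?c (g_on S u) * ?c (g_on T (u - h)) = 0"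
    using g_on_g_on[of T "u - h" S] by (metis diff_add_cancel mult.commute of_real_0 of_real_mult)
  have 3: "?c (g_on (S \<inter> T) (u + h)) =
      ?c (g_on S (u + h)) * ?c (f_on T (u + h)) + ?c (f_on S u) * ?c (g_on T (u + h))"
    using f_on_g_on(1)[of S "u + h" T] by (metis add_diff_cancel_right' of_real_add of_real_mult)
  have 4: "?c (g_on (S \<inter> T) u) = ?c (f_on S u) * ?c (g_on T u) + ?c (g_on S u) * ?c (f_on T (u - h))"
    using f_on_g_on(2)[of S u T] by (metis of_real_add of_real_mult)
  have 5: "?c (f_on (S \<inter> T) u) = ?c (g_on S (u + h)) * ?c (g_on T (u + h)) + ?c (f_on S u) * ?c (f_on T u)
      + ?c (g_on S u) * ?c (g_on T u)"
    using f_on_f_on[of S u T] by (metis of_real_add of_real_mult)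
  \<comment> \<open>Sorts the nine terms of the composition by powers of \<open>w\<close>, so that
    each bracket is one of the five coefficients computed above.\<close>
  have ring: "a * w * (a2 * w * x2 + b1 * x1 + a1 * i * x0) + b * (a1 * w * x1 + b0 * x0 + c0 * i * y1)
      + c * i * (c0 * w * x0 + b' * y1 + c' * i * y2)
    = (a * a2) * w\<^sup>2 * x2 + (a * b1 + b * a1) * w * x1 + (a * a1 + b * b0 + c * c0) * x0
      + (b * c0 + c * b') * i * y1 + (c * c') * i\<^sup>2 * y2"
    for a b c a1 a2 b0 b1 b' c0 c' x0 x1 x2 y1 y2
    using wi by algebra
  have "proj_op S (proj_op T F) (u, t) = proj_op (S \<inter> T) F (u, t)"
    unfolding proj_op_def tridiag_def prod.case add_diff_cancel diff_add_cancel w_def[symmetric]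
      i_def[symmetric] ring 1 2 3 4 5
    by simp
  then show "proj_op S (proj_op T F) (u, t) = proj_op (S \<inter> T) F (u, t)" .
qed

lemma spread_Un:
  "S \<inter> T = {} \<Longrightarrow> spread h b (S \<union> T) u = spread h b S u + spread h b T u"
  by (auto simp: spread_def)

lemma proj_op_Un:
  "S \<inter> T = {} \<Longrightarrow> proj_op (S \<union> T) F z = proj_op S F z + proj_op T F z"
  by (simp add: proj_op_def tridiag_def case_prod_beta spread_Un algebra_simps)

lemma proj_op_empty: "proj_op {} F = (\<lambda>z. 0)"
  by (auto simp: proj_op_def tridiag_def spread_def)

lemma proj_op_add: "proj_op S (\<lambda>z. F z + G z) = (\<lambda>z. proj_op S F z + proj_op S G z)"
  by (auto simp: proj_op_def tridiag_def fun_eq_iff algebra_simps)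

lemma spread_translate: "spread h b ((\<lambda>q. q + N) ` S) u = spread h b S (u - 2 * of_int N * h)"
proof -
  have "(u - 2 * of_int N * h) / (2 * h) = u / (2 * h) - of_int N"
    using h_pos by (simp add: field_simps)
  then have "\<lfloor>(u - 2 * of_int N * h) / (2 * h)\<rfloor> = \<lfloor>u / (2 * h)\<rfloor> - N" by simp
  moreover have "q \<in> (\<lambda>q. q + N) ` S \<longleftrightarrow> q - N \<in> S" for q
    by (auto intro: image_eqI[of _ _ "q - N"])
  moreover have "u - 2 * of_int N * h - 2 * of_int (q - N) * h = u - 2 * of_int q * h" for q
    by (simp add: algebra_simps)
  ultimately show ?thesis unfolding spread_def by (simp only:)
qed

text \<open>An even power of \<open>W\<close> translates by a whole number of cells, so conjugating
  by it merely renumbers them.\<close>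

lemma W_shift_proj_op:
  "W_shift h (2 * N) (proj_op S F) = proj_op ((\<lambda>q. q + N) ` S) (W_shift h (2 * N) F)"
  by (auto simp: W_shift_def proj_op_def tridiag_def spread_translate fun_eq_iff algebra_simps)

section \<open>From cells back to \<open>proj\<close> and its principal module\<close>

lemma f_sum_eq: "f_sum h \<phi> j = f_on {1..int j}"
  using sum_translates_eq_spread[of h "f_fun h \<phi>"] h_pos f_fun_supp by (auto simp: f_sum_def)

lemma g_sum_eq: "g_sum h \<phi> j = g_on {1..int j}"
  using sum_translates_eq_spread[of h "g_fun h \<phi>"] h_pos g_fun_supp by (auto simp: g_sum_def)

lemma cmult_proj:
  assumes "F \<in> schwartz_cyl"
  shows "cmult h (proj h \<phi> j) F = proj_op {1..int j} F"
  unfolding proj_def f_sum_eq g_sum_eq proj_op_def by (rule cmult_tridiag[OF assms])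

text \<open>Stated for the finite sum of globally smooth translates, because the floor in
  \<open>spread\<close> hides smoothness across cell boundaries.\<close>

lemma schwartz_cyl_mult_sum_translates:
  assumes "F \<in> schwartz_cyl" "smooth_real_on UNIV b" "\<And>x. x \<le> 0 \<or> x \<ge> 2 * h \<Longrightarrow> b x = 0"
  shows "(\<lambda>(u, t). of_real (\<Sum>k = 1..j. b (u + c - 2 * real k * h)) * F (u, t)) \<in> schwartz_cyl"
proof -
  have "(\<lambda>z. \<Sum>k = 1..j. (\<lambda>(u, t). of_real (b (u + (c - 2 * real k * h))) * F (u, t)) z) \<in> schwartz_cyl"
    by (intro schwartz_cyl_sum schwartz_cyl_mult_bump[where a = 0 and b = "2 * h"]) (use assms in auto)
  then show ?thesis by (simp add: case_prod_beta' sum_distrib_right add_diff_eq)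
qed

lemma schwartz_cyl_proj_op:
  assumes "F \<in> schwartz_cyl"
  shows "proj_op {1..int j} F \<in> schwartz_cyl"
proof -
  have smooth: "smooth_real_on UNIV (f_fun h \<phi>)" "smooth_real_on UNIV (g_fun h \<phi>)"
    using admissible by (simp_all add: admissible_profile_def)
  have f: "(\<lambda>(u, t). of_real (f_sum h \<phi> j (u + c)) * G (u, t)) \<in> schwartz_cyl"
    and g: "(\<lambda>(u, t). of_real (g_sum h \<phi> j (u + c)) * G (u, t)) \<in> schwartz_cyl"
    if "G \<in> schwartz_cyl" for G c
    unfolding f_sum_def g_sum_def
    by (intro schwartz_cyl_mult_sum_translates that smooth f_fun_supp g_fun_supp; assumption)+
  have "(\<lambda>z. ((\<lambda>(u, t). W t powi 1 * (\<lambda>(u, t). of_real (g_sum h \<phi> j (u + h)) * (\<lambda>(u, t). F (u + h, t)) (u, t)) (u, t)) z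
      + (\<lambda>(u, t). of_real (f_sum h \<phi> j (u + 0)) * F (u, t)) z)
      + (\<lambda>(u, t). W t powi (- 1) * (\<lambda>(u, t). of_real (g_sum h \<phi> j (u + 0)) * (\<lambda>(u, t). F (u + - h, t)) (u, t)) (u, t)) z)
      \<in> schwartz_cyl"
    by (intro schwartz_cyl_add schwartz_cyl_mult_W_powi f g schwartz_cyl_shift assms)
  moreover have "W t powi (- 1) = inverse (W t)" for t by (simp add: power_int_minus)
  ultimately show ?thesis
    unfolding proj_op_def f_sum_eq g_sum_eq
    by (simp add: tridiag_def case_prod_beta' mult_ac)
qed

text \<open>The image of an idempotent is its set of fixed points; membership becomes an equation
  with no preimage to exhibit.\<close>

lemma mcarrier_principal_rmod_iff:
  "x \<in> mcarrier (principal_rmod h (proj h \<phi> j)) \<longleftrightarrow> x \<in> schwartz_cyl \<and> proj_op {1..int j} x = x"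
proof -
  have "x \<in> mcarrier (principal_rmod h (proj h \<phi> j)) \<longleftrightarrow> (\<exists>a\<in>schwartz_cyl. x = proj_op {1..int j} a)"
    by (auto simp: principal_rmod_def cmult_proj intro: cmult_proj[symmetric])
  then show ?thesis
    by (metis schwartz_cyl_proj_op proj_op_proj_op Int_absorb)
qed

end

section \<open>The isomorphism and its inverse\<close>

theorem proposition3p4:
  fixes h :: real and \<phi> :: "real \<Rightarrow> real" and n m :: nat
  assumes "h > 0" and "n \<ge> 1" and "m \<ge> 1"
    and "admissible_profile h \<phi>"
  shows "rmod_isomorphic schwartz_cyl
           (rmod_dsum (principal_rmod h (proj h \<phi> n)) (principal_rmod h (proj h \<phi> m)))
           (principal_rmod h (proj h \<phi> (n + m)))"
proof -
  interpret profile h \<phi> using assms by unfold_locales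
  define L where "L = W_shift h (2 * int n)"
  \<comment> \<open>The index is written as twice \<open>- int n\<close> to match
    \<open>W_shift_proj_op\<close>.\<close>
  define L' where "L' = W_shift h (2 * (- int n))"
  define A where "A = {1..int n}"
  define B where "B = {1..int m}"
  define B' where "B' = {int n + 1..int (n + m)}"
  have AB: "{1..int (n + m)} = A \<union> B'" "A \<inter> B' = {}" by (auto simp: A_def B'_def)
  have "(\<lambda>q. q + int n) ` B = B'" "(\<lambda>q. q + - int n) ` B' = B"
    using image_add_atLeastAtMost'[of "int n" 1 "int m"] image_add_atLeastAtMost'[of "- int n" "int n + 1" "int (n + m)"]
    by (simp_all add: B_def B'_def add.commute)
  then have L: "L (proj_op B F) = proj_op B' (L F)" "L' (proj_op B' F) = proj_op B (L' F)" for F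
    by (simp_all add: L_def L'_def W_shift_proj_op del: mult_minus_right)
  have LL: "L (L' F) = F" "L' (L F) = F" for F
    by (simp_all add: L_def L'_def W_shift_inverse)
  have L_schwartz: "L F \<in> schwartz_cyl" "L' F \<in> schwartz_cyl" if "F \<in> schwartz_cyl" for F
    using that by (simp_all add: L_def L'_def schwartz_cyl_W_shift)
  have orth: "proj_op A (proj_op B' F) z = 0" "proj_op B' (proj_op A F) z = 0" for F z
    using AB(2) by (simp_all add: proj_op_proj_op proj_op_empty Int_commute)
  have carrier: "x \<in> mcarrier (principal_rmod h (proj h \<phi> n)) \<longleftrightarrow> x \<in> schwartz_cyl \<and> proj_op A x = x"
    "x \<in> mcarrier (principal_rmod h (proj h \<phi> m)) \<longleftrightarrow> x \<in> schwartz_cyl \<and> proj_op B x = x"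
    "x \<in> mcarrier (principal_rmod h (proj h \<phi> (n + m))) \<longleftrightarrow>
       x \<in> schwartz_cyl \<and> (\<lambda>z. proj_op A x z + proj_op B' x z) = x" for x
    using proj_op_Un[OF AB(2), of x]
    by (simp_all only: mcarrier_principal_rmod_iff A_def[symmetric] B_def[symmetric] AB(1) fun_eq_iff)
  define \<Phi> where "\<Phi> = (\<lambda>(x, y) z. x z + L y z)"
  define \<Psi> where "\<Psi> = (\<lambda>x. (proj_op A x, L' (proj_op B' x)))"
  let ?M = "mcarrier (principal_rmod h (proj h \<phi> n)) \<times> mcarrier (principal_rmod h (proj h \<phi> m))"
  let ?N = "mcarrier (principal_rmod h (proj h \<phi> (n + m)))"
  have proj_\<Phi>: "proj_op A (\<Phi> (x, y)) = x" "proj_op B' (\<Phi> (x, y)) = L y"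
    if "(x, y) \<in> ?M" for x y
  proof -
    have x: "proj_op A x = x" and y: "proj_op B' (L y) = L y"
      using that L(1)[of y] by (simp_all add: carrier)
    show "proj_op A (\<Phi> (x, y)) = x" "proj_op B' (\<Phi> (x, y)) = L y"
      using orth(1)[of "L y"] orth(2)[of x] by (simp_all add: \<Phi>_def proj_op_add x y)
  qed
  have "bij_betw \<Phi> ?M ?N"
  proof (rule bij_betw_byWitness[where f' = \<Psi>])
    show "\<forall>p\<in>?M. \<Psi> (\<Phi> p) = p"
      by (auto simp del: mem_Times_iff simp: \<Psi>_def proj_\<Phi> LL)
    show "\<forall>x\<in>?N. \<Phi> (\<Psi> x) = x"
      by (auto simp: \<Phi>_def \<Psi>_def LL carrier)
    show "\<Phi> ` ?M \<subseteq> ?N"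
    proof clarify
      fix x y
      assume xy: "x \<in> mcarrier (principal_rmod h (proj h \<phi> n))" "y \<in> mcarrier (principal_rmod h (proj h \<phi> m))"
      then have "\<Phi> (x, y) \<in> schwartz_cyl"
        by (simp add: \<Phi>_def carrier L_schwartz schwartz_cyl_add)
      with xy show "\<Phi> (x, y) \<in> ?N"
        unfolding carrier(3) by (simp add: proj_\<Phi>) (simp add: \<Phi>_def)
    qed
    show "\<Psi> ` ?N \<subseteq> ?M"
    proof (rule image_subsetI)
      fix x assume "x \<in> ?N"
      then have x: "x \<in> schwartz_cyl" by (simp add: carrier)
      \<comment> \<open>The set \<open>B'\<close> does not start at 1, so the second component is
        recognised as Schwartz after transport to \<open>B\<close>, through
        \<open>L' (proj_op B' x) = proj_op B (L' x)\<close>.\<close>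
      then have "proj_op A x \<in> schwartz_cyl" "proj_op B (L' x) \<in> schwartz_cyl"
        unfolding A_def B_def by (simp_all add: schwartz_cyl_proj_op L_schwartz)
      then show "\<Psi> x \<in> ?M"
        by (simp add: \<Psi>_def carrier L proj_op_proj_op)
    qed
  qed
  then show ?thesis
    unfolding rmod_isomorphic_def
  proof (intro exI[of _ \<Phi>] conjI ballI allI)
    let ?D = "rmod_dsum (principal_rmod h (proj h \<phi> n)) (principal_rmod h (proj h \<phi> m))"
    assume "bij_betw \<Phi> ?M ?N"
    then show "bij_betw \<Phi> (mcarrier ?D) ?N" by (simp add: rmod_dsum_def)
    show "\<Phi> (madd ?D p q) = madd (principal_rmod h (proj h \<phi> (n + m))) (\<Phi> p) (\<Phi> q)" for p q
      by (cases p; cases q)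
        (simp add: rmod_dsum_def principal_rmod_def \<Phi>_def L_def W_shift_add add_ac)
    show "\<Phi> (mscale ?D c p) = mscale (principal_rmod h (proj h \<phi> (n + m))) c (\<Phi> p)" for c p
      by (cases p)
        (simp add: rmod_dsum_def principal_rmod_def \<Phi>_def L_def W_shift_scale distrib_left)
    show "\<Phi> (mact ?D p a) = mact (principal_rmod h (proj h \<phi> (n + m))) (\<Phi> p) a"
      if "p \<in> mcarrier ?D" "a \<in> schwartz_cyl" for p a
    proof -
      obtain x y where p: "p = (x, y)" by (cases p)
      have "x \<in> schwartz_cyl" "y \<in> schwartz_cyl"
        using that(1) by (simp_all add: p rmod_dsum_def carrier)
      then have "cmult h (\<lambda>z. x z + L y z) a = (\<lambda>z. cmult h x a z + L (cmult h y a) z)"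
        using that(2) L_schwartz by (simp add: cmult_add_left) (simp add: L_def cmult_W_shift)
      then show ?thesis
        by (simp add: p rmod_dsum_def principal_rmod_def \<Phi>_def)
    qed
  qed
qed

end
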